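(* Let $\mathbb K$ be a field of characteristic zero, $m,n$ positive integers and $r$ an integer with $2<r<n$. Let $E$ be the edge set of the complete bipartite graph $K_{m,n}$, $N=\#E$, and identify $E$ with $\{1,\ldots,N\}$. Let $M^r_{K_{m,n}}$ be the matroid on $E$ whose bases are the edge sets of the forests in $K_{m,n}$ with exactly $r$ edges, $\Phi=\sum_B\prod_{b\in B}x_b$ (sum over bases), and $A=\mathbb K[x_1,\ldots,x_N]/\mathrm{Ann}(\Phi)=\bigoplus_{j=0}^rA_j$. Let $L=x_1+\cdots+x_N$. Then the multiplication map $\times L^{r-2}\colon A_1\to A_{r-1}$ is bijective.
   Context: $\mathrm{Ann}(\Phi)=\{P\in\mathbb K[x_1,\ldots,x_N]: P(\partial/\partial x_1,\ldots,\partial/\partial x_N)\Phi=0\}$, a homogeneous ideal; $A_j$ is the degree-$j$ homogeneous component of the graded quotient algebra $A$. The matroid $M^r_{K_{m,n}}$ is the truncation to rank $r$ of the graphic matroid of $K_{m,n}$. *)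

theory Defs
  imports "HOL-Library.Poly_Mapping" "HOL-Algebra.QuotRing"
begin

section \<open>Polynomials\<close>

text \<open>
  A polynomial maps exponent vectors to coefficients; the ring operations on this type are those of
  \<^theory>\<open>HOL-Library.Poly_Mapping\<close>. The indeterminates are indexed by all of \<^typ>\<open>'x\<close>; the
  polynomial ring in the indeterminates from a set \<open>E\<close> is \<open>poly_ring E\<close>.
\<close>

type_synonym ('x, 'k) mpoly = "('x \<Rightarrow>\<^sub>0 nat) \<Rightarrow>\<^sub>0 'k"

definition Const :: "'k \<Rightarrow> ('x, 'k::zero) mpoly"
  where "Const c = Poly_Mapping.single 0 c"

definition Var :: "'x \<Rightarrow> ('x, 'k::zero_neq_one) mpoly"
  where "Var e = Poly_Mapping.single (Poly_Mapping.single e 1) 1"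

definition monom_deg :: "('x \<Rightarrow>\<^sub>0 nat) \<Rightarrow> nat"
  where "monom_deg s = (\<Sum>e\<in>Poly_Mapping.keys s. Poly_Mapping.lookup s e)"

definition poly_ring :: "'x set \<Rightarrow> ('x, 'k::comm_ring_1) mpoly ring"
  where "poly_ring E =
    \<lparr>carrier = {p. \<forall>s\<in>Poly_Mapping.keys p. Poly_Mapping.keys s \<subseteq> E},
     monoid.mult = (*), one = 1, ring.zero = 0, add = (+)\<rparr>"

definition homogeneous :: "'x set \<Rightarrow> nat \<Rightarrow> ('x, 'k::comm_ring_1) mpoly set"
  where "homogeneous E j =
    {p \<in> carrier (poly_ring E). \<forall>s\<in>Poly_Mapping.keys p. monom_deg s = j}"

section \<open>Polynomials acting as differential operators\<close>

text \<open>In the summand of \<open>partial\<close> with exponent \<open>0\<close> at \<open>e\<close>, the truncated subtraction is harmless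
  because the coefficient vanishes.\<close>

definition partial :: "'x \<Rightarrow> ('x, 'k::comm_ring_1) mpoly \<Rightarrow> ('x, 'k) mpoly"
  where "partial e p = (\<Sum>s\<in>Poly_Mapping.keys p.
    Poly_Mapping.single (s - Poly_Mapping.single e 1)
      (of_nat (Poly_Mapping.lookup s e) * Poly_Mapping.lookup p s))"

text \<open>The composition of the powers of the partial derivatives given by an exponent vector; the order
  of composition is irrelevant by \<open>partial_commute\<close> below.\<close>

definition partial_monom :: "('x \<Rightarrow>\<^sub>0 nat) \<Rightarrow> ('x, 'k::comm_ring_1) mpoly \<Rightarrow> ('x, 'k) mpoly"
  where "partial_monom s p =
    Finite_Set.fold (\<lambda>e. partial e ^^ Poly_Mapping.lookup s e) p (Poly_Mapping.keys s)"

definition diff_op :: "('x, 'k::comm_ring_1) mpoly \<Rightarrow> ('x, 'k) mpoly \<Rightarrow> ('x, 'k) mpoly"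
  where "diff_op P F =
    (\<Sum>s\<in>Poly_Mapping.keys P. Const (Poly_Mapping.lookup P s) * partial_monom s F)"

definition Ann :: "'x set \<Rightarrow> ('x, 'k::comm_ring_1) mpoly \<Rightarrow> ('x, 'k) mpoly set"
  where "Ann E F = {P \<in> carrier (poly_ring E). diff_op P F = 0}"

section \<open>The graded quotient algebra\<close>

definition quot_alg :: "'x set \<Rightarrow> ('x, 'k::comm_ring_1) mpoly \<Rightarrow> ('x, 'k) mpoly set ring"
  where "quot_alg E F = poly_ring E Quot Ann E F"

definition residue_class ::
    "'x set \<Rightarrow> ('x, 'k::comm_ring_1) mpoly \<Rightarrow> ('x, 'k) mpoly \<Rightarrow> ('x, 'k) mpoly set"
  where "residue_class E F P = Ann E F +>\<^bsub>poly_ring E\<^esub> P"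

definition quot_alg_comp ::
    "'x set \<Rightarrow> ('x, 'k::comm_ring_1) mpoly \<Rightarrow> nat \<Rightarrow> ('x, 'k) mpoly set set"
  where "quot_alg_comp E F j = residue_class E F ` homogeneous E j"

section \<open>Graphs, forests and bases\<close>

text \<open>An edge is the set of its two end vertices; the edge sets considered are those of simple graphs.
  A cycle is given by the cyclic list of its vertices.\<close>

definition is_cycle :: "'v set set \<Rightarrow> 'v list \<Rightarrow> bool"
  where "is_cycle F vs \<longleftrightarrow> length vs \<ge> 3 \<and> distinct vs \<and>
    (\<forall>i<length vs. {vs ! i, vs ! (Suc i mod length vs)} \<in> F)"

definition forest :: "'v set set \<Rightarrow> bool"
  where "forest F \<longleftrightarrow> (\<nexists>vs. is_cycle F vs)"

definition complete_bipartite :: "nat \<Rightarrow> nat \<Rightarrow> (nat + nat) set set"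
  where "complete_bipartite m n = {{Inl i, Inr j} | i j. i < m \<and> j < n}"

definition truncated_graphic_bases :: "'v set set \<Rightarrow> nat \<Rightarrow> 'v set set set"
  where "truncated_graphic_bases E r = {B. B \<subseteq> E \<and> forest B \<and> card B = r}"

definition basis_gen_poly :: "'e set set \<Rightarrow> ('e, 'k::comm_ring_1) mpoly"
  where "basis_gen_poly \<B> = (\<Sum>B\<in>\<B>. \<Prod>b\<in>B. Var b)"

section \<open>Well-definedness\<close>

lemma lookup_partial:
  "Poly_Mapping.lookup (partial e p) s =
     of_nat (Suc (Poly_Mapping.lookup s e)) * Poly_Mapping.lookup p (s + Poly_Mapping.single e 1)"
proof -
  let ?u = "s + Poly_Mapping.single e (1::nat)"
  have eq: "t - Poly_Mapping.single e 1 = s \<longleftrightarrow> t = ?u" if "Poly_Mapping.lookup t e \<noteq> 0" for t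
  proof
    assume "t - Poly_Mapping.single e 1 = s"
    moreover have "t - Poly_Mapping.single e 1 + Poly_Mapping.single e 1 = t"
      using that by (intro poly_mapping_eqI) (auto simp: lookup_add lookup_minus lookup_single when_def)
    ultimately show "t = ?u" by simp
  qed auto
  have "Poly_Mapping.lookup (partial e p) s =
    (\<Sum>t\<in>Poly_Mapping.keys p. if t = ?u then
       of_nat (Poly_Mapping.lookup t e) * Poly_Mapping.lookup p t else 0)"
    unfolding partial_def lookup_sum
  proof (intro sum.cong refl)
    fix t
    show "Poly_Mapping.lookup (Poly_Mapping.single (t - Poly_Mapping.single e 1)
        (of_nat (Poly_Mapping.lookup t e) * Poly_Mapping.lookup p t)) s =
      (if t = ?u then of_nat (Poly_Mapping.lookup t e) * Poly_Mapping.lookup p t else 0)"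
      using eq[of t] by (cases "Poly_Mapping.lookup t e = 0") (auto simp: lookup_single when_def)
  qed
  also have "\<dots> = of_nat (Poly_Mapping.lookup ?u e) * Poly_Mapping.lookup p ?u"
    by (simp add: in_keys_iff)
  finally show ?thesis by (simp add: lookup_add)
qed

lemma partial_commute: "partial e (partial f p) = partial f (partial e p)"
  by (cases "e = f"; intro poly_mapping_eqI)
     (auto simp: lookup_partial lookup_add lookup_single when_def ac_simps)

lemma lookup_Const_mult:
  "Poly_Mapping.lookup (Const c * p) s = c * Poly_Mapping.lookup p s"
proof -
  have "Const c * p = Poly_Mapping.map ((*) c) p"
    unfolding Const_def by (rule mult_map_scale_conv_mult[symmetric])
  thus ?thesis by (simp add: Poly_Mapping.map.rep_eq when_def)
qed

lemma partial_pow_commute: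
  "(partial e ^^ i) ((partial f ^^ j) p) = (partial f ^^ j) ((partial e ^^ i) p)"
proof -
  have "partial e ((partial f ^^ j) q) = (partial f ^^ j) (partial e q)" for q :: "('a, 'b) mpoly"
    by (induction j) (simp_all add: partial_commute[of e f])
  thus ?thesis
    by (induction i) simp_all
qed

lemma comp_fun_commute_partial: "comp_fun_commute (\<lambda>e. partial e ^^ k e)"
  by unfold_locales (auto simp: fun_eq_iff partial_pow_commute)

lemma partial_monom_superset:
  assumes "finite A" "Poly_Mapping.keys s \<subseteq> A"
  shows "partial_monom s p = Finite_Set.fold (\<lambda>e. partial e ^^ Poly_Mapping.lookup s e) p A"
proof -
  interpret comp_fun_commute "\<lambda>e. partial e ^^ Poly_Mapping.lookup s e"
    by (rule comp_fun_commute_partial)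
  have "finite D \<Longrightarrow> D \<inter> Poly_Mapping.keys s = {} \<Longrightarrow>
     Finite_Set.fold (\<lambda>e. partial e ^^ Poly_Mapping.lookup s e) p (Poly_Mapping.keys s \<union> D) =
     partial_monom s p" for D
    by (induction D rule: finite_induct) (auto simp: partial_monom_def in_keys_iff)
  from this[of "A - Poly_Mapping.keys s"] show ?thesis
    using assms by (simp add: Un_absorb1 Int_commute Int_Diff)
qed

lemma partial_monom_add:
  "partial_monom (s + t) p = partial_monom s (partial_monom t p)"
proof -
  define A where "A = Poly_Mapping.keys s \<union> Poly_Mapping.keys t"
  have A: "finite A" "Poly_Mapping.keys s \<subseteq> A" "Poly_Mapping.keys t \<subseteq> A"
      "Poly_Mapping.keys (s + t) \<subseteq> A"
    using Poly_Mapping.keys_add[of s t] by (auto simp: A_def)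
  interpret S: comp_fun_commute "\<lambda>e. partial e ^^ Poly_Mapping.lookup s e"
    by (rule comp_fun_commute_partial)
  interpret T: comp_fun_commute "\<lambda>e. partial e ^^ Poly_Mapping.lookup t e"
    by (rule comp_fun_commute_partial)
  interpret ST: comp_fun_commute "\<lambda>e. partial e ^^ Poly_Mapping.lookup (s + t) e"
    by (rule comp_fun_commute_partial)
  have comm: "Finite_Set.fold (\<lambda>e. partial e ^^ Poly_Mapping.lookup s e) ((partial f ^^ j) q) B =
     (partial f ^^ j) (Finite_Set.fold (\<lambda>e. partial e ^^ Poly_Mapping.lookup s e) q B)"
    if "finite B" for B f j q
    using that by (induction B rule: finite_induct) (simp_all add: partial_pow_commute)
  have "Finite_Set.fold (\<lambda>e. partial e ^^ Poly_Mapping.lookup (s + t) e) p B =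
     Finite_Set.fold (\<lambda>e. partial e ^^ Poly_Mapping.lookup s e)
       (Finite_Set.fold (\<lambda>e. partial e ^^ Poly_Mapping.lookup t e) p B) B" if "finite B" for B
    using that
  proof (induction B rule: finite_induct)
    case (insert x B)
    have "(partial x ^^ Poly_Mapping.lookup (s + t) x) q =
        (partial x ^^ Poly_Mapping.lookup s x) ((partial x ^^ Poly_Mapping.lookup t x) q)" for q
      by (simp add: lookup_add funpow_add)
    with insert show ?case
      by (simp add: comm)
  qed simp
  thus ?thesis
    using A by (simp add: partial_monom_superset[where A = A])
qed

lemma partial_add: "partial e (p + q) = partial e p + partial e q"
  by (intro poly_mapping_eqI) (simp add: lookup_partial lookup_add algebra_simps)

lemma partial_Const_mult: "partial e (Const c * p) = Const c * partial e p"
  by (intro poly_mapping_eqI) (simp add: lookup_partial lookup_Const_mult mult.left_commute)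

lemma
  shows partial_monom_plus: "partial_monom s (p + q) = partial_monom s p + partial_monom s q"
    and partial_monom_Const_mult: "partial_monom s (Const c * p) = Const c * partial_monom s p"
proof -
  interpret comp_fun_commute "\<lambda>e. partial e ^^ Poly_Mapping.lookup s e"
    by (rule comp_fun_commute_partial)
  have add: "(partial e ^^ j) (u + v) = (partial e ^^ j) u + (partial e ^^ j) v" for e j u v
    by (induction j) (simp_all add: partial_add)
  have scale: "(partial e ^^ j) (Const c * u) = Const c * (partial e ^^ j) u" for e j c u
    by (induction j) (simp_all add: partial_Const_mult)
  have "Finite_Set.fold (\<lambda>e. partial e ^^ Poly_Mapping.lookup s e) (p + q) B =
      Finite_Set.fold (\<lambda>e. partial e ^^ Poly_Mapping.lookup s e) p B +
      Finite_Set.fold (\<lambda>e. partial e ^^ Poly_Mapping.lookup s e) q B" if "finite B" for B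
    using that by (induction B rule: finite_induct) (simp_all add: add)
  thus "partial_monom s (p + q) = partial_monom s p + partial_monom s q"
    by (simp add: partial_monom_def)
  have "Finite_Set.fold (\<lambda>e. partial e ^^ Poly_Mapping.lookup s e) (Const c * p) B =
      Const c * Finite_Set.fold (\<lambda>e. partial e ^^ Poly_Mapping.lookup s e) p B" if "finite B" for B
    using that by (induction B rule: finite_induct) (simp_all add: scale)
  thus "partial_monom s (Const c * p) = Const c * partial_monom s p"
    by (simp add: partial_monom_def)
qed

lemma partial_monom_zero: "partial_monom s 0 = 0"
  using partial_monom_plus[of s 0 0] by simp

lemma Const_add: "Const (a + b) = Const a + Const b"
  by (simp add: Const_def single_add)

lemma Const_zero [simp]: "Const 0 = 0"
  by (simp add: Const_def)

lemma Const_mult: "Const (a * b) = Const a * Const b"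
  by (simp add: Const_def mult_single)

lemma diff_op_superset:
  assumes "finite A" "Poly_Mapping.keys P \<subseteq> A"
  shows "diff_op P F = (\<Sum>s\<in>A. Const (Poly_Mapping.lookup P s) * partial_monom s F)"
  unfolding diff_op_def
  by (rule sum.mono_neutral_left) (use assms in \<open>auto simp: in_keys_iff\<close>)

lemma diff_op_add_left: "diff_op (P + Q) F = diff_op P F + diff_op Q F"
proof -
  let ?A = "Poly_Mapping.keys P \<union> Poly_Mapping.keys Q"
  have "finite ?A" "Poly_Mapping.keys (P + Q) \<subseteq> ?A"
    using Poly_Mapping.keys_add[of P Q] by auto
  thus ?thesis
    by (simp add: diff_op_superset[where A = ?A] lookup_add Const_add algebra_simps sum.distrib)
qed

lemma diff_op_zero_left [simp]: "diff_op 0 F = 0"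
  by (simp add: diff_op_def)

lemma diff_op_zero_right [simp]: "diff_op P 0 = 0"
  by (simp add: diff_op_def partial_monom_zero)

lemma diff_op_add_right: "diff_op P (F + G) = diff_op P F + diff_op P G"
  by (simp add: diff_op_def partial_monom_plus algebra_simps sum.distrib)

lemma diff_op_single: "diff_op (Poly_Mapping.single s c) F = Const c * partial_monom s F"
  by (simp add: diff_op_def)

lemma mpoly_induct [case_names zero add]:
  assumes "Q 0" "\<And>p s c. Q p \<Longrightarrow> Q (Poly_Mapping.single s c + p)"
  shows "Q (p :: ('x, 'k::comm_ring_1) mpoly)"
proof -
  have "p = (\<Sum>s\<in>Poly_Mapping.keys p. Poly_Mapping.single s (Poly_Mapping.lookup p s))"
    by (intro poly_mapping_eqI) (auto simp: lookup_sum lookup_single when_def in_keys_iff)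
  moreover have "Q (\<Sum>s\<in>B. Poly_Mapping.single s (Poly_Mapping.lookup p s))" if "finite B" for B
    using that by (induction B rule: finite_induct) (simp_all add: assms)
  ultimately show ?thesis
    by (metis finite_keys)
qed

lemma diff_op_mult: "diff_op (P * Q) F = diff_op P (diff_op Q F)"
proof (induction P rule: mpoly_induct)
  case zero
  show ?case by simp
next
  case (add P s c)
  have "diff_op (Poly_Mapping.single s c * Q) F = diff_op (Poly_Mapping.single s c) (diff_op Q F)"
  proof (induction Q rule: mpoly_induct)
    case (add Q t d)
    thus ?case
      by (simp add: distrib_left diff_op_add_left diff_op_add_right mult_single diff_op_single
          partial_monom_add partial_monom_Const_mult Const_mult mult.assoc)
  qed simp
  with add show ?case
    by (simp add: distrib_right diff_op_add_left)
qed

lemma cring_poly_ring: "cring (poly_ring E :: ('x, 'k::comm_ring_1) mpoly ring)"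
proof -
  let ?C = "{p :: ('x, 'k) mpoly. \<forall>s\<in>Poly_Mapping.keys p. Poly_Mapping.keys s \<subseteq> E}"
  have add: "p + q \<in> ?C" if "p \<in> ?C" "q \<in> ?C" for p q
    using that Poly_Mapping.keys_add[of p q] by blast
  have mult: "p * q \<in> ?C" if pq: "p \<in> ?C" "q \<in> ?C" for p q
  proof (rule CollectI, rule ballI)
    fix s assume "s \<in> Poly_Mapping.keys (p * q)"
    then obtain t u where "s = t + u" "t \<in> Poly_Mapping.keys p" "u \<in> Poly_Mapping.keys q"
      using keys_mult[of p q] by blast
    thus "Poly_Mapping.keys s \<subseteq> E"
      using pq Poly_Mapping.keys_add[of t u] by blast
  qed
  have neg: "- p \<in> ?C" if "p \<in> ?C" for p
    using that by (simp add: in_keys_iff)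
  have [simp]: "carrier (poly_ring E) = ?C" "x \<oplus>\<^bsub>poly_ring E\<^esub> y = x + y"
    "x \<otimes>\<^bsub>poly_ring E\<^esub> y = x * y" "\<zero>\<^bsub>poly_ring E\<^esub> = (0 :: ('x, 'k) mpoly)"
    "\<one>\<^bsub>poly_ring E\<^esub> = (1 :: ('x, 'k) mpoly)" for x y :: "('x, 'k) mpoly"
    by (simp_all add: poly_ring_def)
  show ?thesis
  proof (intro cringI abelian_groupI comm_monoidI)
    fix x y :: "('x, 'k) mpoly"
    assume xy: "x \<in> carrier (poly_ring E)" "y \<in> carrier (poly_ring E)"
    show "x \<oplus>\<^bsub>poly_ring E\<^esub> y \<in> carrier (poly_ring E)"
      using add xy by (simp only: \<open>carrier (poly_ring E) = ?C\<close> \<open>x \<oplus>\<^bsub>poly_ring E\<^esub> y = x + y\<close>)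
    show "x \<otimes>\<^bsub>poly_ring E\<^esub> y \<in> carrier (poly_ring E)"
      using mult xy by (simp only: \<open>carrier (poly_ring E) = ?C\<close> \<open>x \<otimes>\<^bsub>poly_ring E\<^esub> y = x * y\<close>)
  next
    fix x :: "('x, 'k) mpoly" assume "x \<in> carrier (poly_ring E)"
    thus "\<exists>y\<in>carrier (poly_ring E). y \<oplus>\<^bsub>poly_ring E\<^esub> x = \<zero>\<^bsub>poly_ring E\<^esub>"
      using neg[of x] by (intro bexI[of _ "- x"]) simp_all
  qed (simp_all add: algebra_simps)
qed

lemma ideal_Ann:
  fixes F :: "('a, 'b::comm_ring_1) mpoly"
  shows "ideal (Ann E F) (poly_ring E)"
proof -
  interpret R: cring "poly_ring E :: ('a, 'b) mpoly ring"
    by (rule cring_poly_ring)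
  have [simp]: "x \<oplus>\<^bsub>poly_ring E\<^esub> y = x + y" "x \<otimes>\<^bsub>poly_ring E\<^esub> y = x * y"
    "\<zero>\<^bsub>poly_ring E\<^esub> = 0" "\<one>\<^bsub>poly_ring E\<^esub> = (1 :: ('a, 'b) mpoly)" for x y :: "('a, 'b) mpoly"
    by (simp_all add: poly_ring_def)
  have mult: "x * a \<in> Ann E F" if "a \<in> Ann E F" "x \<in> carrier (poly_ring E)" for a x
    using that R.m_closed[of x a] by (simp add: Ann_def diff_op_mult)
  show ?thesis
  proof (rule idealI)
    show "subgroup (Ann E F) (add_monoid (poly_ring E))"
    proof (rule R.add.subgroupI)
      show "Ann E F \<subseteq> carrier (poly_ring E)"
        by (auto simp: Ann_def)
      show "Ann E F \<noteq> {}"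
        using R.zero_closed by (auto simp: Ann_def intro!: exI[of _ 0])
      fix a assume a: "a \<in> Ann E F"
      hence ac: "a \<in> carrier (poly_ring E)" by (simp add: Ann_def)
      have "\<ominus>\<^bsub>poly_ring E\<^esub> a = (\<ominus>\<^bsub>poly_ring E\<^esub> \<one>\<^bsub>poly_ring E\<^esub>) * a"
        using R.l_minus[OF R.one_closed ac] ac by simp
      thus "\<ominus>\<^bsub>poly_ring E\<^esub> a \<in> Ann E F"
        using mult[OF a R.a_inv_closed[OF R.one_closed]] by (simp only:)
      fix b assume "b \<in> Ann E F"
      thus "a \<oplus>\<^bsub>poly_ring E\<^esub> b \<in> Ann E F"
        using a R.a_closed[of a b] by (simp add: Ann_def diff_op_add_left)
    qed
  next
    fix a x :: "('a, 'b) mpoly" assume *: "a \<in> Ann E F" "x \<in> carrier (poly_ring E)"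
    show "x \<otimes>\<^bsub>poly_ring E\<^esub> a \<in> Ann E F" using mult[OF *] by simp
    show "a \<otimes>\<^bsub>poly_ring E\<^esub> x \<in> Ann E F" using mult[OF *] by (simp add: mult.commute)
  qed (rule R.ring_axioms)
qed

lemma cring_quot_alg: "cring (quot_alg E F)"
  unfolding quot_alg_def by (rule ideal.quotient_is_cring[OF ideal_Ann cring_poly_ring])

end

theory Submission
  imports Defs "HOL-Combinatorics.Permutations"
begin

text \<open>
  For edges \<open>e \<noteq> f\<close>, applying \<open>L\<^sup>r\<^sup>-\<^sup>2 x\<^sub>e x\<^sub>f\<close> to \<open>\<Phi>\<close> gives \<open>(r - 2)!\<close> times the number of bases
  containing \<open>e\<close> and \<open>f\<close>, and for \<open>e = f\<close> it gives \<open>0\<close>. It suffices that this symmetric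
  \<open>E \<times> E\<close> matrix is invertible. By symmetry its off-diagonal entries take three values:
  \<open>\<alpha>\<close> if \<open>e\<close> and \<open>f\<close> share a left vertex, \<open>\<beta>\<close> if they share a right vertex, \<open>\<gamma>\<close> if they are
  disjoint. Its eigenvalues are positive multiples of
  \<open>\<alpha> (n - 1) + \<beta> (m - 1) + \<gamma> (m - 1) (n - 1)\<close>, \<open>(n - 1) (\<alpha> - \<gamma>) - \<beta>\<close>, \<open>(m - 1) (\<beta> - \<gamma>) - \<alpha>\<close> and
  \<open>\<gamma> - \<alpha> - \<beta>\<close>, so it is enough that \<open>\<alpha>, \<beta> > 0\<close>, \<open>\<alpha> \<le> \<gamma>\<close>, \<open>\<beta> \<le> \<gamma>\<close> and \<open>\<gamma> < \<alpha> + \<beta>\<close> (for \<open>m \<ge> 2\<close>).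
  These inequalities hold summand by summand when the bases through two edges of a fixed
  4-cycle are sorted by their remaining \<open>r - 2\<close> edges \<open>G\<close>: which pairs of edges of the cycle
  extend \<open>G\<close> to a forest depends only on how \<open>G\<close> connects the four vertices.
\<close>

section \<open>Homogeneous polynomials and differential operators\<close>

lemma carrier_poly_ring:
  "carrier (poly_ring E) = {p. \<forall>s\<in>Poly_Mapping.keys p. Poly_Mapping.keys s \<subseteq> E}"
  by (simp add: poly_ring_def)

lemma poly_ring_ops [simp]:
  "x \<oplus>\<^bsub>poly_ring E\<^esub> y = x + y" "x \<otimes>\<^bsub>poly_ring E\<^esub> y = x * y"
  "\<zero>\<^bsub>poly_ring E\<^esub> = 0" "\<one>\<^bsub>poly_ring E\<^esub> = 1"
  by (simp_all add: poly_ring_def)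

lemma poly_ring_minus:
  fixes x y :: "('x, 'k::comm_ring_1) mpoly"
  assumes "x \<in> carrier (poly_ring E)" "y \<in> carrier (poly_ring E)"
  shows "x \<ominus>\<^bsub>poly_ring E\<^esub> y = x - y"
proof -
  interpret R: cring "poly_ring E :: ('x, 'k) mpoly ring"
    by (rule cring_poly_ring)
  have "\<ominus>\<^bsub>poly_ring E\<^esub> y + y = 0"
    using R.l_neg[OF assms(2)] by simp
  hence "\<ominus>\<^bsub>poly_ring E\<^esub> y = - y"
    by (simp add: eq_neg_iff_add_eq_0)
  thus ?thesis
    by (simp add: a_minus_def)
qed

lemma poly_ring_nat_pow:
  fixes x :: "('x, 'k::comm_ring_1) mpoly"
  shows "x [^]\<^bsub>poly_ring E\<^esub> (k::nat) = x ^ k"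
  by (induction k) (simp_all add: nat_pow_def mult.commute)

section \<open>Homogeneous polynomials, and how products and derivatives shift the degree\<close>

lemma homogeneous_iff:
  "p \<in> homogeneous E j \<longleftrightarrow>
    (\<forall>s. Poly_Mapping.lookup p s \<noteq> 0 \<longrightarrow> Poly_Mapping.keys s \<subseteq> E \<and> monom_deg s = j)"
  by (auto simp: homogeneous_def carrier_poly_ring in_keys_iff)

lemma homogeneous_carrier: "p \<in> homogeneous E j \<Longrightarrow> p \<in> carrier (poly_ring E)"
  by (simp add: homogeneous_def)

lemma monom_deg_superset:
  assumes "finite A" "Poly_Mapping.keys s \<subseteq> A"
  shows "monom_deg s = (\<Sum>e\<in>A. Poly_Mapping.lookup s e)"
  unfolding monom_deg_def
  by (rule sum.mono_neutral_left) (use assms in \<open>auto simp: in_keys_iff\<close>)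

lemma monom_deg_add: "monom_deg (s + t) = monom_deg s + monom_deg t"
proof -
  let ?A = "Poly_Mapping.keys s \<union> Poly_Mapping.keys t"
  have "finite ?A" "Poly_Mapping.keys (s + t) \<subseteq> ?A"
    using Poly_Mapping.keys_add[of s t] by auto
  thus ?thesis
    by (simp add: monom_deg_superset[where A = ?A] lookup_add sum.distrib)
qed

lemma monom_deg_single [simp]: "monom_deg (Poly_Mapping.single e k) = k"
  by (simp add: monom_deg_def)

lemma keys_add_nat:
  "Poly_Mapping.keys (s + t :: 'x \<Rightarrow>\<^sub>0 nat) = Poly_Mapping.keys s \<union> Poly_Mapping.keys t"
  by (auto simp: in_keys_iff lookup_add)

lemma monom_deg_eq_1D:
  assumes "monom_deg s = 1"
  obtains e where "s = Poly_Mapping.single e 1" "e \<in> Poly_Mapping.keys s"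
proof -
  from assms obtain e where e: "e \<in> Poly_Mapping.keys s" "Poly_Mapping.lookup s e = 1"
    and rest: "\<And>f. f \<in> Poly_Mapping.keys s \<Longrightarrow> f \<noteq> e \<Longrightarrow> Poly_Mapping.lookup s f = 0"
    unfolding monom_deg_def by (auto simp: sum_eq_Suc0_iff)
  have "s = Poly_Mapping.single e 1"
    using e rest by (intro poly_mapping_eqI) (auto simp: lookup_single when_def in_keys_iff)
  with e that show thesis by blast
qed

lemma homogeneous_zero [simp]: "0 \<in> homogeneous E j"
  by (simp add: homogeneous_iff)

lemma homogeneous_add:
  assumes "p \<in> homogeneous E j" "q \<in> homogeneous E j"
  shows "p + q \<in> homogeneous E j"
  using assms unfolding homogeneous_iff lookup_add by (metis add_0)

lemma homogeneous_uminus: "p \<in> homogeneous E j \<Longrightarrow> - p \<in> homogeneous E j"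
  by (simp add: homogeneous_iff)

lemma homogeneous_diff:
  "p \<in> homogeneous E j \<Longrightarrow> q \<in> homogeneous E j \<Longrightarrow> p - q \<in> homogeneous E j"
  using homogeneous_add[OF _ homogeneous_uminus] by fastforce

lemma homogeneous_sum:
  "(\<And>a. a \<in> A \<Longrightarrow> f a \<in> homogeneous E j) \<Longrightarrow> sum f A \<in> homogeneous E j"
  by (induction A rule: infinite_finite_induct) (auto intro: homogeneous_add)

lemma homogeneous_mult:
  assumes "p \<in> homogeneous E j" "q \<in> homogeneous E k"
  shows "p * q \<in> homogeneous E (j + k)"
proof -
  have "Poly_Mapping.keys s \<subseteq> E \<and> monom_deg s = j + k" if "s \<in> Poly_Mapping.keys (p * q)" for s
  proof -
    from that obtain t u where "s = t + u" "t \<in> Poly_Mapping.keys p" "u \<in> Poly_Mapping.keys q"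
      using keys_mult[of p q] by blast
    thus ?thesis
      using assms by (auto simp: homogeneous_iff in_keys_iff keys_add_nat monom_deg_add)
  qed
  thus ?thesis by (simp add: homogeneous_iff in_keys_iff)
qed

lemma homogeneous_Const [simp]: "Const c \<in> homogeneous E 0"
  by (auto simp: homogeneous_iff Const_def lookup_single when_def monom_deg_def)

lemma homogeneous_one [simp]: "1 \<in> homogeneous E 0"
  by (auto simp: homogeneous_iff lookup_one when_def monom_deg_def)

lemma homogeneous_Var: "e \<in> E \<Longrightarrow> Var e \<in> homogeneous E 1"
  by (auto simp: homogeneous_iff Var_def lookup_single when_def)

lemma homogeneous_power: "p \<in> homogeneous E j \<Longrightarrow> p ^ k \<in> homogeneous E (k * j)"
  by (induction k) (auto dest: homogeneous_mult)

lemma homogeneous_prod_Var: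
  assumes "finite B" "B \<subseteq> E"
  shows "(\<Prod>b\<in>B. Var b) \<in> homogeneous E (card B)"
  using assms
proof (induction B rule: finite_induct)
  case (insert b B)
  thus ?case
    using homogeneous_mult[OF homogeneous_Var[of b E], of "\<Prod>b\<in>B. Var b" "card B"] by simp
qed simp

text \<open>For \<open>j = 0\<close> the truncated \<open>j - 1\<close> does no harm: a constant has
  derivative \<open>0\<close>, which is homogeneous of every degree.\<close>

lemma homogeneous_partial:
  assumes "p \<in> homogeneous E j"
  shows "partial e p \<in> homogeneous E (j - 1)"
proof -
  have "Poly_Mapping.keys s \<subseteq> E \<and> monom_deg s = j - 1"
    if "Poly_Mapping.lookup (partial e p) s \<noteq> 0" for s
  proof -
    from that have "Poly_Mapping.lookup p (s + Poly_Mapping.single e 1) \<noteq> 0"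
      by (auto simp: lookup_partial)
    with assms show ?thesis
      by (force simp: homogeneous_iff keys_add_nat monom_deg_add)
  qed
  thus ?thesis by (simp add: homogeneous_iff)
qed

lemma homogeneous_partial_monom:
  fixes p :: "('x, 'k::comm_ring_1) mpoly"
  assumes "p \<in> homogeneous E j"
  shows "partial_monom s p \<in> homogeneous E (j - monom_deg s)"
proof -
  interpret comp_fun_commute "\<lambda>e. partial e ^^ Poly_Mapping.lookup s e"
    by (rule comp_fun_commute_partial)
  have pow: "(partial e ^^ k) q \<in> homogeneous E (i - k)" if "q \<in> homogeneous E i" for e k i and q :: "('x, 'k) mpoly"
    using that by (induction k) (auto dest: homogeneous_partial)
  have "Finite_Set.fold (\<lambda>e. partial e ^^ Poly_Mapping.lookup s e) p B
      \<in> homogeneous E (j - (\<Sum>e\<in>B. Poly_Mapping.lookup s e))" if "finite B" for B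
    using that
  proof (induction B rule: finite_induct)
    case (insert x B)
    show ?case
      using pow[OF insert.IH, where e = x and k = "Poly_Mapping.lookup s x"] insert.hyps
      by (simp add: add.commute)
  qed (simp add: assms)
  thus ?thesis by (simp add: partial_monom_def monom_deg_def)
qed

lemma homogeneous_diff_op:
  assumes "P \<in> homogeneous E j" "F \<in> homogeneous E k"
  shows "diff_op P F \<in> homogeneous E (k - j)"
  unfolding diff_op_def
proof (rule homogeneous_sum)
  fix s assume "s \<in> Poly_Mapping.keys P"
  hence "monom_deg s = j"
    using assms(1) by (simp add: homogeneous_iff in_keys_iff)
  thus "Const (Poly_Mapping.lookup P s) * partial_monom s F \<in> homogeneous E (k - j)"
    using homogeneous_mult[OF homogeneous_Const homogeneous_partial_monom[OF assms(2), of s]]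
    by simp
qed

lemma linear_form_eq:
  assumes "finite E" "p \<in> homogeneous E 1"
  shows "p = (\<Sum>e\<in>E. Const (Poly_Mapping.lookup p (Poly_Mapping.single e 1)) * Var e)"
proof (rule poly_mapping_eqI)
  fix s
  let ?q = "\<Sum>e\<in>E. Const (Poly_Mapping.lookup p (Poly_Mapping.single e 1)) * Var e"
  have q: "Poly_Mapping.lookup ?q s = (\<Sum>e\<in>E. if s = Poly_Mapping.single e 1
      then Poly_Mapping.lookup p s else 0)"
    by (auto simp: lookup_sum lookup_Const_mult Var_def lookup_single when_def intro!: sum.cong)
  show "Poly_Mapping.lookup p s = Poly_Mapping.lookup ?q s"
  proof (cases "Poly_Mapping.lookup p s = 0")
    case True
    thus ?thesis unfolding q True by simp
  next
    case False
    hence s: "monom_deg s = 1" "Poly_Mapping.keys s \<subseteq> E"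
      using assms(2) by (auto simp: homogeneous_iff)
    then obtain f where f: "s = Poly_Mapping.single f 1" "f \<in> E"
      by (metis monom_deg_eq_1D subsetD)
    have "(\<Sum>e\<in>E. if s = Poly_Mapping.single e 1 then Poly_Mapping.lookup p s else 0) =
        (\<Sum>e\<in>E. if e = f then Poly_Mapping.lookup p s else 0)"
      using f by (intro sum.cong refl) (metis lookup_single_eq lookup_single_not_eq zero_neq_one)
    thus ?thesis
      unfolding q using assms(1) f by simp
  qed
qed

lemma diff_op_Const: "diff_op (Const c) F = Const c * F"
  by (simp add: Const_def diff_op_single partial_monom_def)

lemma Const_one [simp]: "Const 1 = 1"
  by (simp add: Const_def)

lemma diff_op_Var: "diff_op (Var e) F = partial e F"
proof -
  interpret comp_fun_commute "\<lambda>f. partial f ^^ Poly_Mapping.lookup (Poly_Mapping.single e (1::nat)) f"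
    by (rule comp_fun_commute_partial)
  show ?thesis
    by (simp add: Var_def diff_op_single partial_monom_def fold_insert[of "{}", simplified]
        flip: Const_def)
qed

lemma partial_zero [simp]: "partial e 0 = 0"
  by (simp add: partial_def)

lemma partial_diff: "partial e (p - q) = partial e p - partial e q"
  using partial_add[of e "p - q" q] by (simp add: algebra_simps)

lemma diff_op_sum_left: "diff_op (sum P A) F = (\<Sum>a\<in>A. diff_op (P a) F)"
  by (induction A rule: infinite_finite_induct) (simp_all add: diff_op_add_left)

lemma diff_op_sum_right: "diff_op P (sum F A) = (\<Sum>a\<in>A. diff_op P (F a))"
  by (induction A rule: infinite_finite_induct) (simp_all add: diff_op_add_right)

lemma diff_op_diff_left: "diff_op (P - Q) F = diff_op P F - diff_op Q F"
  using diff_op_add_left[of "P - Q" Q F] by (simp add: algebra_simps)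

lemma Const_sum: "Const (sum c A) = (\<Sum>a\<in>A. Const (c a))"
  by (induction A rule: infinite_finite_induct) (simp_all add: Const_add)

lemma Const_eq_iff: "Const a = Const b \<longleftrightarrow> a = b"
  by (metis Const_def lookup_single_eq)

text \<open>The constant term of \<open>partial e p\<close> is the coefficient of
  \<open>Var e\<close> in \<open>p\<close>.\<close>

lemma linear_form_zeroI:
  assumes "finite E" "p \<in> homogeneous E 1" "\<And>e. e \<in> E \<Longrightarrow> partial e p = 0"
  shows "p = 0"
proof -
  have "Poly_Mapping.lookup p (Poly_Mapping.single e 1) = 0" if "e \<in> E" for e
    using lookup_partial[of e p 0] assms(3)[OF that] by simp
  thus ?thesis
    by (subst linear_form_eq[OF assms(1,2)]) simp
qed

section \<open>Derivatives of squarefree monomials\<close>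

lemma prod_Var:
  "finite B \<Longrightarrow> (\<Prod>b\<in>B. Var b) = Poly_Mapping.single (\<Sum>b\<in>B. Poly_Mapping.single b 1) 1"
  by (induction B rule: finite_induct) (simp_all add: Var_def mult_single)

text \<open>All exponents are 0 or 1, so a derivative either deletes one factor, with coefficient 1,
  or kills the monomial.\<close>

lemma partial_prod_Var:
  assumes "finite B"
  shows "partial e (\<Prod>b\<in>B. Var b) = (if e \<in> B then \<Prod>b\<in>B - {e}. Var b else 0)"
proof -
  have lk: "Poly_Mapping.lookup (\<Sum>b\<in>B. Poly_Mapping.single b (1::nat)) e = (if e \<in> B then 1 else 0)"
    using assms by (simp add: lookup_sum lookup_single when_def)
  have "(\<Sum>b\<in>B. Poly_Mapping.single b (1::nat)) - Poly_Mapping.single e 1 =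
      (\<Sum>b\<in>B - {e}. Poly_Mapping.single b 1)" if "e \<in> B"
    using assms that by (simp add: sum.remove)
  thus ?thesis
    using assms by (simp add: prod_Var partial_def lk[simplified])
qed

text \<open>Each application of \<open>L\<close> sums over all ways to delete one factor, so
  \<open>fact k\<close> counts the orders in which the elements of \<open>B\<close> are
  removed.\<close>

lemma diff_op_sum_Var_power:
  fixes L :: "('x, 'k::comm_ring_1) mpoly"
  assumes "L = (\<Sum>e\<in>E. Var e)" and "finite E" "B \<subseteq> E" "card B = k"
  shows "diff_op (L ^ k) (\<Prod>b\<in>B. Var b) = Const (of_nat (fact k))"
  using assms(3,4)
proof (induction k arbitrary: B)
  case 0
  hence "B = {}" using assms(2) finite_subset[of B E] by auto
  thus ?case using diff_op_Const[of 1 1] by (simp add: Const_def)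
next
  case (Suc k)
  have fin: "finite B" using Suc.prems assms(2) finite_subset by blast
  have "diff_op (L ^ Suc k) (\<Prod>b\<in>B. Var b) =
      diff_op (L ^ k) (\<Sum>e\<in>E. partial e (\<Prod>b\<in>B. Var b))"
    using assms(1) by (simp only: power_Suc2 diff_op_mult diff_op_sum_left diff_op_Var)
  also have "(\<Sum>e\<in>E. partial e (\<Prod>b\<in>B. Var b)) = (\<Sum>e\<in>B. \<Prod>b\<in>B - {e}. Var b)"
    using Suc.prems assms(2) by (simp add: partial_prod_Var fin sum.If_cases Int_absorb1)
  also have "diff_op (L ^ k) \<dots> = (\<Sum>e\<in>B. Const (of_nat (fact k)))"
    unfolding diff_op_sum_right
  proof (rule sum.cong[OF refl])
    fix e assume "e \<in> B"
    thus "diff_op (L ^ k) (\<Prod>b\<in>B - {e}. Var b) = Const (of_nat (fact k))"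
      using Suc.prems fin by (intro Suc.IH) auto
  qed
  also have "\<dots> = Const (of_nat (fact (Suc k)))"
    unfolding Const_sum[symmetric] using Suc.prems by (simp add: Const_eq_iff algebra_simps)
  finally show ?case .
qed

text \<open>\<open>Var e * Var f\<close> keeps the bases through both edges, and
  \<open>L ^ (r - 2)\<close> turns each of the remaining monomials into the same constant. The
  diagonal vanishes because the monomials are squarefree.\<close>

lemma diff_op_basis_gen_poly:
  fixes L :: "('x, 'k::comm_ring_1) mpoly"
  assumes L: "L = (\<Sum>e\<in>E. Var e)" and fin: "finite E"
    and \<B>: "\<And>B. B \<in> \<B> \<Longrightarrow> B \<subseteq> E \<and> card B = r"
  shows "diff_op (L ^ (r - 2) * (Var e * Var f)) (basis_gen_poly \<B>) =
    Const (if e = f then 0 else of_nat (fact (r - 2) * card {B \<in> \<B>. e \<in> B \<and> f \<in> B}))"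
proof -
  have fin\<B>: "finite \<B>"
    by (rule finite_subset[of _ "Pow E"]) (use \<B> fin in auto)
  have one: "diff_op (L ^ (r - 2) * (Var e * Var f)) (\<Prod>b\<in>B. Var b) =
      Const (if e \<noteq> f \<and> e \<in> B \<and> f \<in> B then of_nat (fact (r - 2)) else 0)" if "B \<in> \<B>" for B
  proof -
    have B: "finite B" "B \<subseteq> E" "card B = r" using \<B>[OF that] fin finite_subset[of B E] by auto
    show ?thesis
    proof (cases "e \<noteq> f \<and> e \<in> B \<and> f \<in> B")
      case True
      hence "card (B - {f} - {e}) = r - 2" using B by simp
      hence "diff_op (L ^ (r - 2)) (\<Prod>b\<in>B - {f} - {e}. Var b) =
          Const (of_nat (fact (r - 2)))"
        using B by (intro diff_op_sum_Var_power[OF L fin]) auto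
      thus ?thesis using True B(1)
        by (simp add: diff_op_mult diff_op_Var partial_prod_Var)
    next
      case False
      thus ?thesis using B(1)
        by (auto simp: diff_op_mult diff_op_Var partial_prod_Var)
    qed
  qed
  have "diff_op (L ^ (r - 2) * (Var e * Var f)) (basis_gen_poly \<B>) =
     Const (\<Sum>B\<in>\<B>. if e \<noteq> f \<and> e \<in> B \<and> f \<in> B then of_nat (fact (r - 2)) else 0)"
    unfolding basis_gen_poly_def diff_op_sum_right Const_sum by (intro sum.cong refl one)
  also have "(\<Sum>B\<in>\<B>. if e \<noteq> f \<and> e \<in> B \<and> f \<in> B then of_nat (fact (r - 2)) else (0::'k)) =
      (if e = f then 0 else of_nat (fact (r - 2) * card {B \<in> \<B>. e \<in> B \<and> f \<in> B}))"
    using fin\<B> by (auto simp: sum.If_cases Int_def mult.commute)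
  finally show ?thesis .
qed

text \<open>\<open>H\<close> is the matrix of the bilinear form that sends linear forms
  \<open>p\<close>, \<open>q\<close> to the action of \<open>L ^ (r - 2) * p * q\<close> on
  \<open>F\<close>. A class of degree \<open>r - 1\<close> is known from its pairings with the
  variables, so bijectivity becomes invertibility of \<open>H\<close>. Surjectivity of
  \<open>H\<close> is the assumption; injectivity follows because \<open>H\<close> is
  symmetric.\<close>

lemma bij_betw_mult_power_residue_class:
  fixes F L :: "('x, 'k::comm_ring_1) mpoly"
  assumes fin: "finite E" and F: "F \<in> homogeneous E r" and L: "L \<in> homogeneous E 1" and r: "2 \<le> r"
    and H: "\<And>e f. e \<in> E \<Longrightarrow> f \<in> E \<Longrightarrow> diff_op (L ^ (r - 2) * (Var e * Var f)) F = Const (H e f)"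
    and surj: "\<And>w. \<exists>v. \<forall>f\<in>E. (\<Sum>e\<in>E. v e * H e f) = w f"
  shows "bij_betw
    (\<lambda>a. (residue_class E F L [^]\<^bsub>quot_alg E F\<^esub> (r - 2)) \<otimes>\<^bsub>quot_alg E F\<^esub> a)
    (quot_alg_comp E F 1) (quot_alg_comp E F (r - 1))"
proof -
  let ?R = "poly_ring E :: ('x, 'k) mpoly ring"
  interpret R: cring ?R by (rule cring_poly_ring)
  interpret I: ideal "Ann E F" ?R by (rule ideal_Ann)
  interpret h: ring_hom_ring ?R "quot_alg E F" "residue_class E F"
    using I.rcos_ring_hom_ring
    by (simp add: quot_alg_def residue_class_def[abs_def])
  have class_eq: "residue_class E F p = residue_class E F q \<longleftrightarrow> diff_op (p - q) F = 0"
    if "p \<in> carrier ?R" "q \<in> carrier ?R" for p q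
  proof -
    have "residue_class E F p = residue_class E F q \<longleftrightarrow> p - q \<in> Ann E F"
      using R.quotient_eq_iff_same_a_r_cos[OF ideal_Ann that]
      by (simp only: residue_class_def poly_ring_minus[OF that])
    moreover have "p - q \<in> carrier ?R"
      using R.minus_closed[OF that] by (simp only: poly_ring_minus[OF that])
    ultimately show ?thesis unfolding Ann_def by blast
  qed
  have Lk: "L ^ (r - 2) \<in> homogeneous E (r - 2)"
    using homogeneous_power[OF L, of "r - 2"] by simp
  have mult: "residue_class E F L [^]\<^bsub>quot_alg E F\<^esub> (r - 2) \<otimes>\<^bsub>quot_alg E F\<^esub> residue_class E F p =
      residue_class E F (L ^ (r - 2) * p)" if "p \<in> homogeneous E 1" for p
    using h.hom_nat_pow[OF homogeneous_carrier[OF L], of "r - 2"]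
      h.hom_mult[OF homogeneous_carrier[OF Lk] homogeneous_carrier[OF that]]
    by (simp only: poly_ring_nat_pow poly_ring_ops)
  have Lp: "L ^ (r - 2) * p \<in> homogeneous E (r - 1)" if "p \<in> homogeneous E 1" for p
    using homogeneous_mult[OF Lk that] r by (simp add: numeral_2_eq_2 Suc_diff_Suc)
  \<comment> \<open>Differentiating by \<open>f\<close> after the action is the action of the
    product with \<open>Var f\<close>.\<close>
  have pairing: "partial f (diff_op (L ^ (r - 2) * (\<Sum>e\<in>E. Const (v e) * Var e)) F) =
      Const (\<Sum>e\<in>E. v e * H e f)" if "f \<in> E" for f v
  proof -
    have "partial f (diff_op (L ^ (r - 2) * (\<Sum>e\<in>E. Const (v e) * Var e)) F) =
        diff_op (Var f * (L ^ (r - 2) * (\<Sum>e\<in>E. Const (v e) * Var e))) F"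
      by (simp add: diff_op_mult diff_op_Var)
    also have "Var f * (L ^ (r - 2) * (\<Sum>e\<in>E. Const (v e) * Var e)) =
        (\<Sum>e\<in>E. Const (v e) * (L ^ (r - 2) * (Var e * Var f)))"
      by (simp add: sum_distrib_left algebra_simps)
    also have "diff_op \<dots> F = Const (\<Sum>e\<in>E. v e * H e f)"
      unfolding diff_op_sum_left Const_sum
      using that by (intro sum.cong refl) (simp add: diff_op_mult[of "Const _"] diff_op_Const H Const_mult)
    finally show ?thesis .
  qed
  have sym: "H e f = H f e" if "e \<in> E" "f \<in> E" for e f
    using H[OF that] H[OF that(2,1)] by (metis Const_eq_iff mult.commute)
  \<comment> \<open>Pair \<open>v\<close> with a preimage \<open>u\<close> of the indicator of
    \<open>e0\<close>; by symmetry \<open>H\<close> can be moved from \<open>u\<close> to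
    \<open>v\<close>, where it gives 0.\<close>
  have inj: "v e0 = 0" if v: "\<And>f. f \<in> E \<Longrightarrow> (\<Sum>e\<in>E. v e * H e f) = 0" and e0: "e0 \<in> E" for v e0
  proof -
    obtain u where u: "\<And>f. f \<in> E \<Longrightarrow> (\<Sum>e\<in>E. u e * H e f) = of_bool (f = e0)"
      using surj[of "\<lambda>f. of_bool (f = e0)"] by blast
    have "v e0 = (\<Sum>f\<in>E. v f * of_bool (f = e0))"
      using fin e0 by (simp add: of_bool_def if_distrib cong: if_cong)
    also have "\<dots> = (\<Sum>f\<in>E. v f * (\<Sum>e\<in>E. u e * H e f))"
      using u by simp
    also have "\<dots> = (\<Sum>f\<in>E. \<Sum>e\<in>E. u e * (v f * H e f))"
      by (simp add: sum_distrib_left mult.left_commute)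
    also have "\<dots> = (\<Sum>e\<in>E. u e * (\<Sum>f\<in>E. v f * H f e))"
      by (subst sum.swap) (simp add: sum_distrib_left sym cong: sum.cong)
    also have "\<dots> = 0" using v by simp
    finally show ?thesis .
  qed
  show ?thesis
  proof (rule bij_betw_imageI)
    show "inj_on (\<lambda>a. (residue_class E F L [^]\<^bsub>quot_alg E F\<^esub> (r - 2)) \<otimes>\<^bsub>quot_alg E F\<^esub> a)
      (quot_alg_comp E F 1)"
    proof (rule inj_onI, unfold quot_alg_comp_def, elim imageE, hypsubst)
      fix p q assume pq: "p \<in> homogeneous E 1" "q \<in> homogeneous E 1"
        and "residue_class E F L [^]\<^bsub>quot_alg E F\<^esub> (r - 2) \<otimes>\<^bsub>quot_alg E F\<^esub> residue_class E F p =
           residue_class E F L [^]\<^bsub>quot_alg E F\<^esub> (r - 2) \<otimes>\<^bsub>quot_alg E F\<^esub> residue_class E F q"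
      hence "residue_class E F (L ^ (r - 2) * p) = residue_class E F (L ^ (r - 2) * q)"
        by (simp only: mult)
      hence "diff_op (L ^ (r - 2) * p - L ^ (r - 2) * q) F = 0"
        using class_eq pq[THEN Lp, THEN homogeneous_carrier] by blast
      hence z: "diff_op (L ^ (r - 2) * (p - q)) F = 0"
        by (simp add: algebra_simps)
      define v where "v = (\<lambda>e. Poly_Mapping.lookup (p - q) (Poly_Mapping.single e 1))"
      have exp: "p - q = (\<Sum>e\<in>E. Const (v e) * Var e)"
        unfolding v_def by (rule linear_form_eq[OF fin homogeneous_diff[OF pq]])
      have "(\<Sum>e\<in>E. v e * H e f) = 0" if "f \<in> E" for f
        using pairing[OF that, of v] z unfolding exp[symmetric]
        by (metis Const_eq_iff Const_zero diff_op_Var diff_op_zero_right)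
      hence "v e = 0" if "e \<in> E" for e using inj that by blast
      hence "p - q = 0" by (simp add: exp)
      thus "residue_class E F p = residue_class E F q" by simp
    qed
    show "(\<lambda>a. (residue_class E F L [^]\<^bsub>quot_alg E F\<^esub> (r - 2)) \<otimes>\<^bsub>quot_alg E F\<^esub> a) ` quot_alg_comp E F 1 =
      quot_alg_comp E F (r - 1)"
    proof (intro subset_antisym subsetI)
      fix x assume "x \<in> quot_alg_comp E F (r - 1)"
      then obtain P where P: "P \<in> homogeneous E (r - 1)" "x = residue_class E F P"
        by (auto simp: quot_alg_comp_def)
      have D: "diff_op Q F \<in> homogeneous E 1" if "Q \<in> homogeneous E (r - 1)" for Q
        using homogeneous_diff_op[OF that F] r by simp
      \<comment> \<open>In degree \<open>r - 1\<close> the class of \<open>P\<close> is determined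
        by the linear form \<open>diff_op P F\<close>. Its coefficients \<open>w\<close> are the
        right-hand side of the linear system to solve.\<close>
      define w where "w = (\<lambda>f. Poly_Mapping.lookup (diff_op P F) (Poly_Mapping.single f 1))"
      have w: "partial f (diff_op P F) = Const (w f)" if "f \<in> E" for f
      proof -
        have "partial f (diff_op P F) \<in> homogeneous E 0"
          using homogeneous_partial[OF D[OF P(1)]] by simp
        hence "Poly_Mapping.lookup (partial f (diff_op P F)) s = 0" if "s \<noteq> 0" for s
          using that by (auto simp: homogeneous_iff monom_deg_def in_keys_iff
              poly_mapping_eq_iff fun_eq_iff)
        moreover have "Poly_Mapping.lookup (partial f (diff_op P F)) 0 = w f"
          by (simp add: lookup_partial w_def)
        ultimately show ?thesis
          by (intro poly_mapping_eqI) (auto simp: Const_def lookup_single when_def)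
      qed
      obtain v where v: "\<And>f. f \<in> E \<Longrightarrow> (\<Sum>e\<in>E. v e * H e f) = w f"
        using surj[of w] by blast
      let ?p = "\<Sum>e\<in>E. Const (v e) * Var e"
      have p: "?p \<in> homogeneous E 1"
      proof (rule homogeneous_sum)
        fix e assume "e \<in> E"
        from homogeneous_mult[OF homogeneous_Const homogeneous_Var[OF this], of "v e"]
        show "Const (v e) * Var e \<in> homogeneous E 1" by simp
      qed
      have "diff_op (L ^ (r - 2) * ?p - P) F = 0"
      proof (rule linear_form_zeroI[OF fin D])
        show "L ^ (r - 2) * ?p - P \<in> homogeneous E (r - 1)"
          by (intro homogeneous_diff Lp p P)
        fix f assume f: "f \<in> E"
        show "partial f (diff_op (L ^ (r - 2) * ?p - P) F) = 0"
          using pairing[OF f, of v] w[OF f] v[OF f]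
          by (simp only: diff_op_diff_left partial_diff diff_self)
      qed
      hence "residue_class E F (L ^ (r - 2) * ?p) = x"
        using class_eq[OF homogeneous_carrier[OF Lp[OF p]] homogeneous_carrier[OF P(1)]] P(2) by simp
      thus "x \<in> (\<lambda>a. (residue_class E F L [^]\<^bsub>quot_alg E F\<^esub> (r - 2)) \<otimes>\<^bsub>quot_alg E F\<^esub> a) `
          quot_alg_comp E F 1"
        unfolding mult[OF p, symmetric] quot_alg_comp_def using p by blast
    qed (use mult Lp in \<open>auto simp: quot_alg_comp_def\<close>)
  qed
qed

section \<open>Connectivity and forests\<close>

definition conn :: "'v set set \<Rightarrow> 'v \<Rightarrow> 'v \<Rightarrow> bool"
  where "conn G = (\<lambda>x y. {x, y} \<in> G)\<^sup>*\<^sup>*"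

lemma conn_refl [simp]: "conn G x x"
  by (simp add: conn_def)

lemma conn_sym: "conn G x y \<Longrightarrow> conn G y x"
proof -
  have "symp (\<lambda>x y. {x, y} \<in> G)" by (auto intro: sympI simp: insert_commute)
  thus "conn G x y \<Longrightarrow> conn G y x"
    unfolding conn_def by (metis sympD symp_rtranclp)
qed

lemma conn_commute: "conn G x y \<longleftrightarrow> conn G y x"
  by (rule iffI) (erule conn_sym)+

lemma conn_trans: "conn G x y \<Longrightarrow> conn G y z \<Longrightarrow> conn G x z"
  unfolding conn_def by (rule rtranclp_trans)

lemma conn_edge: "{x, y} \<in> G \<Longrightarrow> conn G x y"
  by (simp add: conn_def r_into_rtranclp)

lemma conn_mono: "G \<subseteq> G' \<Longrightarrow> conn G x y \<Longrightarrow> conn G' x y"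
  unfolding conn_def by (erule rtranclp_mono[THEN predicate2D, rotated]) auto

text \<open>A walk can be shortened until it crosses the new edge at most once, in one of the two
  directions.\<close>

lemma conn_insert_iff:
  "conn (insert {u, v} G) x y \<longleftrightarrow>
     conn G x y \<or> conn G x u \<and> conn G v y \<or> conn G x v \<and> conn G u y"
  (is "_ \<longleftrightarrow> ?R y")
proof
  show "?R y" if "conn (insert {u, v} G) x y"
    using that[unfolded conn_def]
  proof (induction rule: rtranclp_induct)
    case (step y z)
    from step.hyps(2) consider "{y, z} \<in> G" | "y = u" "z = v" | "y = v" "z = u"
      by (auto simp: doubleton_eq_iff)
    thus ?case
      using step.IH by cases (metis conn_trans conn_edge conn_sym conn_refl)+
  qed simp
  have "conn (insert {u, v} G) u v" by (simp add: conn_edge)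
  thus "conn (insert {u, v} G) x y" if "?R y"
    using that conn_mono[of G "insert {u, v} G"]
    by (metis conn_sym conn_trans subset_insertI)
qed

text \<open>The last step of a nontrivial walk to \<open>y\<close> would be an edge containing
  \<open>y\<close>.\<close>

lemma conn_isolated:
  assumes "\<And>e. e \<in> G \<Longrightarrow> y \<notin> e"
  shows "conn G x y \<longleftrightarrow> x = y"
proof
  assume "conn G x y"
  thus "x = y" unfolding conn_def by (cases rule: rtranclp.cases) (use assms in auto)
qed simp

text \<open>Loop erasure: if the next vertex \<open>z\<close> already lies on the path, the path is
  cut off at \<open>z\<close>; otherwise \<open>z\<close> is appended.\<close>

lemma conn_obtain_path:
  assumes "conn G x y"
  obtains p where "p \<noteq> []" "distinct p" "hd p = x" "last p = y"
    "successively (\<lambda>u v. {u, v} \<in> G) p"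
  using assms[unfolded conn_def]
proof (induction arbitrary: thesis rule: rtranclp_induct)
  case base
  show ?case by (rule base[of "[x]"]) auto
next
  case (step y z)
  from step.IH obtain p where p: "p \<noteq> []" "distinct p" "hd p = x" "last p = y"
    "successively (\<lambda>u v. {u, v} \<in> G) p" by blast
  show ?case
  proof (cases "z \<in> set p")
    case True
    then obtain q s where "p = q @ z # s" by (meson split_list)
    hence "p = (q @ [z]) @ s" by simp
    thus ?thesis
      using p by (intro step.prems[of "q @ [z]"])
        (auto simp: successively_append_iff hd_append split: if_splits)
  next
    case False
    thus ?thesis
      using p step.hyps(2) by (intro step.prems[of "p @ [z]"]) (auto simp: successively_append_iff)
  qed
qed

section \<open>Cycles as closed paths, and forests\<close>

lemma is_cycle_iff_path:
  assumes "length p \<ge> 3" "distinct p"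
  shows "is_cycle G p \<longleftrightarrow> successively (\<lambda>u v. {u, v} \<in> G) p \<and> {last p, hd p} \<in> G"
proof -
  obtain k where k: "length p = Suc k" using assms by (cases "length p") auto
  have ne: "p \<noteq> []" using assms by auto
  have "(\<forall>i<length p. {p ! i, p ! (Suc i mod length p)} \<in> G) \<longleftrightarrow>
      (\<forall>i<k. {p ! i, p ! Suc i} \<in> G) \<and> {p ! k, p ! 0} \<in> G"
    unfolding k All_less_Suc by (simp add: conj_commute cong: imp_cong)
  also have "\<dots> \<longleftrightarrow> successively (\<lambda>u v. {u, v} \<in> G) p \<and> {last p, hd p} \<in> G"
    using ne k by (simp add: successively_conv_nth last_conv_nth hd_conv_nth)
  finally show ?thesis using assms by (simp add: is_cycle_def)
qed

lemma is_cycle_rotate: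
  assumes "is_cycle G p"
  shows "is_cycle G (rotate k p)"
proof -
  have "{rotate k p ! i, rotate k p ! (Suc i mod length p)} \<in> G" if "i < length p" for i
  proof -
    have "Suc i mod length p < length p" using that by (auto intro: mod_less_divisor)
    hence "rotate k p ! (Suc i mod length p) = p ! (Suc ((k + i) mod length p) mod length p)"
      by (simp add: nth_rotate mod_simps)
    moreover have "(k + i) mod length p < length p" using that by (auto intro: mod_less_divisor)
    ultimately show ?thesis
      using assms that by (simp add: nth_rotate is_cycle_def)
  qed
  thus ?thesis using assms by (simp add: is_cycle_def)
qed

lemma forest_mono: "forest G \<Longrightarrow> H \<subseteq> G \<Longrightarrow> forest H"
  unfolding forest_def is_cycle_def by blast

text \<open>A path from \<open>u\<close> to \<open>v\<close> in \<open>G\<close> is closed to a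
  cycle by the new edge; it has at least three vertices because \<open>u \<noteq> v\<close> and
  \<open>{u, v}\<close> is not in \<open>G\<close>. Conversely, a cycle that appears only after the
  insertion uses the new edge, and its other edges connect \<open>u\<close> and \<open>v\<close> in
  \<open>G\<close>.\<close>

lemma forest_insert_iff:
  assumes "u \<noteq> v" "{u, v} \<notin> G"
  shows "forest (insert {u, v} G) \<longleftrightarrow> forest G \<and> \<not> conn G u v"
proof (intro iffI conjI notI)
  assume f: "forest (insert {u, v} G)"
  show "forest G" using f by (rule forest_mono) auto
  assume "conn G u v"
  then obtain p where p: "p \<noteq> []" "distinct p" "hd p = u" "last p = v"
    "successively (\<lambda>u v. {u, v} \<in> G) p"
    by (rule conn_obtain_path)
  have "length p \<ge> 3"
  proof (rule ccontr)
    assume "\<not> length p \<ge> 3"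
    then consider "length p = 0" | "length p = 1" | "length p = 2" by linarith
    thus False
      using p assms by cases (auto simp: length_Suc_conv numeral_2_eq_2)
  qed
  moreover have "successively (\<lambda>x y. {x, y} \<in> insert {u, v} G) p"
    using p(5) by (rule successively_mono) auto
  ultimately have "is_cycle (insert {u, v} G) p"
    using p by (simp add: is_cycle_iff_path insert_commute)
  with f show False by (auto simp: forest_def)
next
  assume G: "forest G \<and> \<not> conn G u v"
  show "forest (insert {u, v} G)"
    unfolding forest_def
  proof
    assume "\<exists>vs. is_cycle (insert {u, v} G) vs"
    then obtain p where p: "is_cycle (insert {u, v} G) p" by blast
    from G have "\<not> is_cycle G p" by (auto simp: forest_def)
    with p obtain i where i: "i < length p" "{p ! i, p ! (Suc i mod length p)} = {u, v}"
      unfolding is_cycle_def by blast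
    \<comment> \<open>This rotation moves the step of the cycle that equals \<open>{u, v}\<close> to
      the closing position.\<close>
    let ?q = "rotate (Suc i) p"
    have q: "is_cycle (insert {u, v} G) ?q" by (rule is_cycle_rotate[OF p])
    have l: "length ?q \<ge> 3" "distinct ?q" "?q \<noteq> []" using q by (auto simp: is_cycle_def)
    have "last ?q = p ! i"
      using i(1) l by (simp add: last_conv_nth nth_rotate del: rotate_Suc)
    moreover have "hd ?q = p ! (Suc i mod length p)"
      using i(1) l by (simp add: hd_conv_nth nth_rotate del: rotate_Suc)
    ultimately have ends: "{last ?q, hd ?q} = {u, v}" using i(2) by simp
    have "{?q ! j, ?q ! Suc j} \<in> G" if j: "Suc j < length ?q" for j
    proof -
      \<comment> \<open>Among at least three distinct vertices no other step repeats the closing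
        edge, so all other steps lie in \<open>G\<close>.\<close>
      have "{?q ! j, ?q ! Suc j} \<noteq> {?q ! (length ?q - 1), ?q ! 0}"
        using l j by (auto simp: doubleton_eq_iff nth_eq_iff_index_eq simp del: rotate_Suc length_rotate)
      hence "{?q ! j, ?q ! Suc j} \<noteq> {u, v}"
        using ends l by (simp add: last_conv_nth hd_conv_nth del: rotate_Suc)
      moreover have "{?q ! j, ?q ! Suc j} \<in> insert {u, v} G"
        using q l j unfolding is_cycle_iff_path[OF l(1,2)] successively_conv_nth by blast
      ultimately show ?thesis by blast
    qed
    hence path: "conn G (?q ! 0) (?q ! j)" if "j < length ?q" for j
      using that
      by (induction j) (auto intro: conn_trans conn_edge Suc_lessD simp del: rotate_Suc length_rotate)
    have "conn G (hd ?q) (last ?q)"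
      using path[of "length ?q - 1"] l by (simp add: last_conv_nth hd_conv_nth del: rotate_Suc)
    with ends have "conn G u v"
      by (auto simp: doubleton_eq_iff simp del: rotate_Suc intro: conn_sym)
    with G show False by simp
  qed
qed

section \<open>Adding two edges to a forest\<close>

definition extends_forest :: "'v set set \<Rightarrow> 'v set \<Rightarrow> 'v set \<Rightarrow> bool"
  where "extends_forest G e f \<longleftrightarrow> e \<notin> G \<and> f \<notin> G \<and> forest (insert e (insert f G))"

text \<open>Apply \<open>forest_insert_iff\<close> twice. The last two conjuncts exclude a cycle
  through both new edges, one for each way of traversing them. If an edge is already in
  \<open>G\<close>, both sides are false.\<close>

lemma extends_forest_iff:
  assumes "x \<noteq> y" "z \<noteq> w" "{x, y} \<noteq> {z, w}"
  shows "extends_forest G {x, y} {z, w} \<longleftrightarrow> forest G \<and> \<not> conn G x y \<and> \<not> conn G z w \<and>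
     \<not> (conn G x z \<and> conn G y w) \<and> \<not> (conn G x w \<and> conn G y z)"
proof (cases "{x, y} \<in> G \<or> {z, w} \<in> G")
  case True
  thus ?thesis by (auto simp: extends_forest_def conn_edge)
next
  case False
  thus ?thesis
    using assms by (auto simp: extends_forest_def forest_insert_iff conn_insert_iff intro: conn_sym)
qed

text \<open>By \<open>extends_forest_iff\<close> both inequalities concern only the equivalence
  relation \<open>conn G\<close> on the four vertices of a 4-cycle, which is a finite check. Both
  members of each class must be summed: if a forest \<open>G\<close> connects just \<open>x'\<close>
  with \<open>y'\<close>, then \<open>{x, y}, {x, y'}\<close> extends \<open>G\<close> but
  \<open>{x, y}, {x', y'}\<close> does not.\<close>

lemma
  assumes "distinct [x, x', y, y']"
  shows extends_forest_adjacent_le: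
    "of_bool (extends_forest G {x, y} {x, y'}) + of_bool (extends_forest G {x', y} {x', y'})
     \<le> (of_bool (extends_forest G {x, y} {x', y'}) + of_bool (extends_forest G {x, y'} {x', y}) :: nat)"
      (is ?adjacent)
  and extends_forest_opposite_le:
    "of_bool (extends_forest G {x, y} {x', y'}) + of_bool (extends_forest G {x, y'} {x', y})
    \<le> (of_bool (extends_forest G {x, y} {x, y'}) + of_bool (extends_forest G {x', y} {x', y'}) +
       of_bool (extends_forest G {x, y} {x', y}) + of_bool (extends_forest G {x, y'} {x', y'}) :: nat)"
      (is ?opposite)
proof -
  have sym: "conn G y x \<longleftrightarrow> conn G x y" "conn G y x' \<longleftrightarrow> conn G x' y" "conn G y' x \<longleftrightarrow> conn G x y'"
    "conn G y' x' \<longleftrightarrow> conn G x' y'" "conn G x' x \<longleftrightarrow> conn G x x'" "conn G y' y \<longleftrightarrow> conn G y y'"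
    by (rule conn_commute)+
  have trans: "\<not> conn G a b \<or> \<not> conn G b c \<or> conn G a c" for a b c
    using conn_trans[of G a b c] by blast
  have ne: "{x, y} \<noteq> {x, y'}" "{x', y} \<noteq> {x', y'}" "{x, y} \<noteq> {x', y'}" "{x, y'} \<noteq> {x', y}"
    "{x, y} \<noteq> {x', y}" "{x, y'} \<noteq> {x', y'}" "x \<noteq> y" "x \<noteq> y'" "x' \<noteq> y" "x' \<noteq> y'"
    using assms by (auto simp: doubleton_eq_iff)
  note iffs = extends_forest_iff[OF ne(7,8,1)] extends_forest_iff[OF ne(9,10,2)]
    extends_forest_iff[OF ne(7,10,3)] extends_forest_iff[OF ne(8,9,4)]
    extends_forest_iff[OF ne(7,9,5)] extends_forest_iff[OF ne(8,10,6)]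
  \<comment> \<open>Three instances of transitivity for each of the four triples of
    vertices.\<close>
  note triangles = trans[of x y y'] trans[of y x y'] trans[of x y' y] trans[of x' y y']
    trans[of y x' y'] trans[of x' y' y] trans[of x y x'] trans[of y x x'] trans[of x x' y]
    trans[of x y' x'] trans[of y' x x'] trans[of x x' y']
  show ?adjacent
    unfolding iffs using triangles
    by (cases "conn G x y"; cases "conn G x' y'"; cases "conn G x y'"; cases "conn G x' y";
        cases "conn G x x'"; cases "conn G y y'"; simp add: sym)
  show ?opposite
    unfolding iffs using triangles
    by (cases "conn G x y"; cases "conn G x' y'"; cases "conn G x y'"; cases "conn G x' y";
        cases "conn G x x'"; cases "conn G y y'"; simp add: sym)
qed

section \<open>Counting bases through two edges\<close>

lemma finite_complete_bipartite [simp]: "finite (complete_bipartite m n)"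
proof -
  have "complete_bipartite m n = (\<lambda>(i, j). {Inl i, Inr j}) ` ({..<m} \<times> {..<n})"
    by (auto simp: complete_bipartite_def)
  thus ?thesis by simp
qed

lemma bij_betw_complete_bipartite:
  "bij_betw (\<lambda>(i, j). {Inl i, Inr j}) ({..<m} \<times> {..<n}) (complete_bipartite m n)"
  by (auto simp: bij_betw_def inj_on_def complete_bipartite_def doubleton_eq_iff)

definition num_bases :: "nat \<Rightarrow> nat \<Rightarrow> nat \<Rightarrow> (nat + nat) set \<Rightarrow> (nat + nat) set \<Rightarrow> nat"
  where "num_bases m n r e f =
    card {B \<in> truncated_graphic_bases (complete_bipartite m n) r. e \<in> B \<and> f \<in> B}"

text \<open>Deleting \<open>e\<close> and \<open>f\<close> from a basis is a bijection, as
  \<open>extends_forest\<close> requires both edges to be outside \<open>G\<close>. The index set no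
  longer depends on \<open>e\<close> and \<open>f\<close>, so counts for different pairs can be
  compared summand by summand.\<close>

lemma num_bases_eq_sum:
  assumes "e \<in> complete_bipartite m n" "f \<in> complete_bipartite m n" "e \<noteq> f" "r \<ge> 2"
  shows "num_bases m n r e f =
    (\<Sum>G | G \<subseteq> complete_bipartite m n \<and> card G = r - 2. of_bool (extends_forest G e f))"
proof -
  let ?E = "complete_bipartite m n"
  let ?S = "{G. G \<subseteq> ?E \<and> card G = r - 2}"
  have fin: "finite ?S"
    by (rule finite_subset[of _ "Pow ?E"]) auto
  have finG: "finite G" if "G \<subseteq> ?E" for G
    using that by (rule finite_subset) simp
  have "bij_betw (\<lambda>G. insert e (insert f G)) {G \<in> ?S. extends_forest G e f}
      {B \<in> truncated_graphic_bases ?E r. e \<in> B \<and> f \<in> B}"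
  proof (rule bij_betw_byWitness[where f' = "\<lambda>B. B - {e, f}"])
    show "\<forall>G\<in>{G \<in> ?S. extends_forest G e f}. insert e (insert f G) - {e, f} = G"
      by (auto simp: extends_forest_def)
    show "\<forall>B\<in>{B \<in> truncated_graphic_bases ?E r. e \<in> B \<and> f \<in> B}.
        insert e (insert f (B - {e, f})) = B"
      by auto
    show "(\<lambda>G. insert e (insert f G)) ` {G \<in> ?S. extends_forest G e f} \<subseteq>
        {B \<in> truncated_graphic_bases ?E r. e \<in> B \<and> f \<in> B}"
    proof (rule image_subsetI)
      fix G assume "G \<in> {G \<in> ?S. extends_forest G e f}"
      hence G: "G \<subseteq> ?E" "card G = r - 2" "extends_forest G e f" by auto
      hence "card (insert e (insert f G)) = r"
        using assms(3,4) finG[OF G(1)] by (simp add: extends_forest_def)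
      thus "insert e (insert f G) \<in> {B \<in> truncated_graphic_bases ?E r. e \<in> B \<and> f \<in> B}"
        using G assms by (simp add: extends_forest_def truncated_graphic_bases_def)
    qed
    show "(\<lambda>B. B - {e, f}) ` {B \<in> truncated_graphic_bases ?E r. e \<in> B \<and> f \<in> B} \<subseteq>
        {G \<in> ?S. extends_forest G e f}"
    proof (rule image_subsetI)
      fix B assume "B \<in> {B \<in> truncated_graphic_bases ?E r. e \<in> B \<and> f \<in> B}"
      hence B: "B \<in> truncated_graphic_bases ?E r" "e \<in> B" "f \<in> B" by auto
      hence "insert e (insert f (B - {e, f})) = B" by auto
      thus "B - {e, f} \<in> {G \<in> ?S. extends_forest G e f}"
        using B assms by (auto simp: extends_forest_def truncated_graphic_bases_def card_Diff_subset)
    qed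
  qed
  hence "num_bases m n r e f = card {G \<in> ?S. extends_forest G e f}"
    unfolding num_bases_def by (simp add: bij_betw_same_card)
  also have "\<dots> = (\<Sum>G\<in>?S. of_bool (extends_forest G e f))"
    using fin by (simp add: of_bool_def sum.If_cases Int_def)
  finally show ?thesis .
qed

section \<open>Symmetry under permutations of the two sides\<close>

lemma forest_image:
  assumes "inj h" "forest B"
  shows "forest ((`) h ` B)"
  unfolding forest_def
proof
  assume "\<exists>vs. is_cycle ((`) h ` B) vs"
  then obtain vs where vs: "is_cycle ((`) h ` B) vs" by blast
  \<comment> \<open>Each vertex of the cycle lies on an edge that is an image under
    \<open>h\<close>, so the whole cycle can be pulled back.\<close>
  have sub: "set vs \<subseteq> range h"
  proof
    fix x assume "x \<in> set vs"
    then obtain i where "i < length vs" "x = vs ! i" by (auto simp: in_set_conv_nth)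
    with vs have "\<exists>b. h ` b = {x, vs ! (Suc i mod length vs)}"
      unfolding is_cycle_def by (metis imageE)
    thus "x \<in> range h" by blast
  qed
  then obtain ws where ws: "vs = map h ws"
    by (metis ex_map_conv subset_code(1) rangeE)
  have "is_cycle B ws"
    unfolding is_cycle_def
  proof (intro conjI allI impI)
    fix i assume i: "i < length ws"
    hence "Suc i mod length ws < length ws" by (intro mod_less_divisor) auto
    with i vs have "{h (ws ! i), h (ws ! (Suc i mod length ws))} \<in> (`) h ` B"
      by (force simp: is_cycle_def ws)
    hence "h ` {ws ! i, ws ! (Suc i mod length ws)} \<in> (`) h ` B" by simp
    thus "{ws ! i, ws ! (Suc i mod length ws)} \<in> B"
      using assms(1) by (metis imageE inj_image_eq_iff)
  qed (use vs ws in \<open>auto simp: is_cycle_def distinct_map\<close>)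
  with assms(2) show False by (auto simp: forest_def)
qed

lemma num_bases_permute:
  assumes \<sigma>: "\<sigma> permutes {..<m}" and \<tau>: "\<tau> permutes {..<n}"
  shows "num_bases m n r {Inl (\<sigma> i), Inr (\<tau> j)} {Inl (\<sigma> i'), Inr (\<tau> j')} =
    num_bases m n r {Inl i, Inr j} {Inl i', Inr j'}"
proof -
  let ?E = "complete_bipartite m n"
  let ?\<B> = "truncated_graphic_bases ?E r"
  \<comment> \<open>One inequality for all pairs of permutations suffices, since the inverse
    permutations give the reverse one.\<close>
  have le: "num_bases m n r {Inl i, Inr j} {Inl i', Inr j'} \<le>
      num_bases m n r {Inl (\<sigma> i), Inr (\<tau> j)} {Inl (\<sigma> i'), Inr (\<tau> j')}"
    if \<sigma>: "\<sigma> permutes {..<m}" and \<tau>: "\<tau> permutes {..<n}" for \<sigma> \<tau> i j i' j'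
  proof -
    define h where "h = map_sum \<sigma> \<tau>"
    have h [simp]: "h (Inl i) = Inl (\<sigma> i)" "h (Inr i) = Inr (\<tau> i)" for i
      by (simp_all add: h_def)
    have inj: "inj h"
      unfolding h_def using permutes_inj[OF \<sigma>] permutes_inj[OF \<tau>] by (rule sum.inj_map)
    have injI: "inj ((`) h)" using inj by (simp add: inj_on_image)
    have E: "h ` e \<in> ?E" if "e \<in> ?E" for e
    proof -
      from that obtain k l where "e = {Inl k, Inr l}" "k < m" "l < n"
        by (auto simp: complete_bipartite_def)
      moreover from this have "\<sigma> k < m" "\<tau> l < n"
        using permutes_in_image[OF \<sigma>, of k] permutes_in_image[OF \<tau>, of l] by auto
      ultimately show ?thesis by (auto simp: complete_bipartite_def)
    qed
    have "(`) h ` B \<in> ?\<B>" if "B \<in> ?\<B>" for B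
      using that E forest_image[OF inj, of B] card_image[OF inj_on_subset[OF injI], of B]
      by (auto simp: truncated_graphic_bases_def)
    hence "(\<lambda>B. (`) h ` B) ` {B \<in> ?\<B>. {Inl i, Inr j} \<in> B \<and> {Inl i', Inr j'} \<in> B} \<subseteq>
        {B \<in> ?\<B>. {Inl (\<sigma> i), Inr (\<tau> j)} \<in> B \<and> {Inl (\<sigma> i'), Inr (\<tau> j')} \<in> B}"
      by (auto intro: rev_image_eqI)
    moreover have "finite {B \<in> ?\<B>. e \<in> B \<and> f \<in> B}" for e f
      by (rule finite_subset[of _ "Pow ?E"]) (auto simp: truncated_graphic_bases_def)
    moreover have "inj_on (\<lambda>B. (`) h ` B) A" for A
      using inj_on_image[of "(`) h" A] inj_on_subset[OF injI] by blast
    ultimately show ?thesis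
      unfolding num_bases_def by (intro card_inj_on_le[of "\<lambda>B. (`) h ` B"])
  qed
  show ?thesis
    using le[OF \<sigma> \<tau>, of i j i' j']
      le[OF permutes_inv[OF \<sigma>] permutes_inv[OF \<tau>], of "\<sigma> i" "\<tau> j" "\<sigma> i'" "\<tau> j'"]
    by (simp add: permutes_inverses[OF \<sigma>] permutes_inverses[OF \<tau>])
qed

lemma ex_permutes_one:
  assumes "i < (m::nat)"
  obtains \<sigma> where "\<sigma> permutes {..<m}" "\<sigma> 0 = i"
  using assms by (intro that[of "transpose 0 i"]) (auto intro: permutes_swap_id)

lemma ex_permutes_two:
  assumes "i < (m::nat)" "i' < m" "i \<noteq> i'"
  obtains \<sigma> where "\<sigma> permutes {..<m}" "\<sigma> 0 = i" "\<sigma> 1 = i'"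
proof -
  \<comment> \<open>\<open>k\<close> is the preimage of \<open>i'\<close> under the swap of 0 and
    \<open>i\<close>. As \<open>i' \<noteq> i\<close>, it is not 0, so swapping 1 and
    \<open>k\<close> first leaves 0 fixed.\<close>
  define k where "k = transpose 0 i i'"
  have k: "k < m" "k \<noteq> 0" "1 < m" "transpose 0 i k = i'"
    using assms by (auto simp: k_def transpose_def)
  show thesis
  proof (rule that[of "transpose 0 i \<circ> transpose 1 k"])
    show "transpose 0 i \<circ> transpose 1 k permutes {..<m}"
      using k assms by (intro permutes_compose permutes_swap_id) auto
    show "(transpose 0 i \<circ> transpose 1 k) 0 = i"
      using k(2) by (simp add: transpose_apply_other)
    show "(transpose 0 i \<circ> transpose 1 k) 1 = i'"
      using k(4) by simp
  qed
qed

text \<open>Two distinct edges share a left vertex, share a right vertex or are disjoint. Permuting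
  both sides brings each case to a standard pair, which leaves three counts.\<close>

lemma num_bases_eq:
  assumes "i < m" "i' < m" "j < n" "j' < n" "(i, j) \<noteq> (i', j')"
  shows "num_bases m n r {Inl i, Inr j} {Inl i', Inr j'} =
    num_bases m n r {Inl 0, Inr 0} {Inl (if i = i' then 0 else 1), Inr (if j = j' then 0 else 1)}"
proof -
  obtain \<sigma> where "\<sigma> permutes {..<m}" "\<sigma> 0 = i" "\<sigma> (if i = i' then 0 else 1) = i'"
    using assms(1,2) by (cases "i = i'") (auto elim: ex_permutes_one ex_permutes_two)
  moreover obtain \<tau> where "\<tau> permutes {..<n}" "\<tau> 0 = j" "\<tau> (if j = j' then 0 else 1) = j'"
    using assms(3,4) by (cases "j = j'") (auto elim: ex_permutes_one ex_permutes_two)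
  ultimately show ?thesis
    using num_bases_permute[of \<sigma> m \<tau> n r 0 0 "if i = i' then 0 else 1" "if j = j' then 0 else 1"]
    by metis
qed

section \<open>Comparison of the three counts\<close>

lemma forest_star:
  assumes "finite S" "a \<notin> S"
  shows "forest ((\<lambda>b. {a, b}) ` S)"
  using assms
proof (induction S rule: finite_induct)
  case empty
  show ?case by (auto simp: forest_def is_cycle_def intro!: exI[of _ 0])
next
  case (insert b S)
  \<comment> \<open>\<open>b\<close> is a new leaf, isolated until its edge is added, so that edge
    closes no cycle.\<close>
  have iso: "b \<notin> e" if "e \<in> (\<lambda>b. {a, b}) ` S" for e
    using that insert by auto
  hence "{a, b} \<notin> (\<lambda>b. {a, b}) ` S" by blast
  thus ?case
    using insert conn_isolated[of _ b a, OF iso] by (simp add: forest_insert_iff)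
qed

lemma num_bases_inequalities:
  assumes "m \<ge> 1" "2 < r" "r < n"
  shows "num_bases m n r {Inl 0, Inr 0} {Inl 0, Inr 1} > 0"
    and "m \<ge> 2 \<Longrightarrow> num_bases m n r {Inl 0, Inr 0} {Inl 1, Inr 0} > 0"
    and "m \<ge> 2 \<Longrightarrow> num_bases m n r {Inl 0, Inr 0} {Inl 1, Inr 1} <
      num_bases m n r {Inl 0, Inr 0} {Inl 0, Inr 1} + num_bases m n r {Inl 0, Inr 0} {Inl 1, Inr 0}"
    and "m \<ge> 2 \<Longrightarrow> num_bases m n r {Inl 0, Inr 0} {Inl 0, Inr 1} \<le>
      num_bases m n r {Inl 0, Inr 0} {Inl 1, Inr 1}"
    and "m \<ge> 2 \<Longrightarrow> num_bases m n r {Inl 0, Inr 0} {Inl 1, Inr 0} \<le>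
      num_bases m n r {Inl 0, Inr 0} {Inl 1, Inr 1}"
proof -
  let ?E = "complete_bipartite m n"
  let ?S = "{G. G \<subseteq> ?E \<and> card G = r - 2}"
  let ?N = "num_bases m n r"
  have fin: "finite ?S"
    by (rule finite_subset[of _ "Pow ?E"]) auto
  have edge: "{Inl i, Inr j} \<in> ?E" if "i < m" "j < n" for i j
    using that by (auto simp: complete_bipartite_def)
  \<comment> \<open>A star at \<open>Inl 0\<close> with \<open>r - 2\<close> leaves, available
    because \<open>r < n\<close>. It leaves \<open>Inl 1\<close>, \<open>Inr 0\<close> and
    \<open>Inr 1\<close> isolated, so every adjacent pair of edges of the 4-cycle extends it; this
    gives positivity and the strict inequality.\<close>
  define G0 :: "(nat + nat) set set" where "G0 = (\<lambda>b. {Inl 0, b}) ` Inr ` {2..<r}"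
  have "inj_on (\<lambda>b. {Inl 0, b}) (Inr ` {2..<r} :: (nat + nat) set)"
    by (auto simp: inj_on_def doubleton_eq_iff)
  hence "card G0 = r - 2"
    unfolding G0_def by (subst card_image) (auto simp: card_image)
  hence G0: "G0 \<in> ?S"
    using assms by (auto simp: G0_def intro: edge)
  have forest: "forest G0"
    unfolding G0_def by (rule forest_star) auto
  have conn: "conn G0 x y \<longleftrightarrow> x = y" if "y \<in> {Inl 1, Inr 0, Inr 1}" for x y
    using that by (intro conn_isolated) (auto simp: G0_def)
  have ext: "extends_forest G0 {Inl 0, Inr 0} {Inl 0, Inr 1}"
    "extends_forest G0 {Inl 1, Inr 0} {Inl 1, Inr 1}"
    "extends_forest G0 {Inl 0, Inr 0} {Inl 1, Inr 0}"
    "extends_forest G0 {Inl 0, Inr 1} {Inl 1, Inr 1}"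
    by (simp_all add: extends_forest_iff doubleton_eq_iff forest conn)
  have N: "?N {Inl i, Inr j} {Inl i', Inr j'} =
      (\<Sum>G\<in>?S. of_bool (extends_forest G {Inl i, Inr j} {Inl i', Inr j'}))"
    if "i < m" "i' < m" "j < n" "j' < n" "(i, j) \<noteq> (i', j')" for i j i' j'
    using that assms edge by (intro num_bases_eq_sum) (auto simp: doubleton_eq_iff)
  have pos: "(\<Sum>G\<in>?S. of_bool (extends_forest G e f)) > (0::nat)" if "extends_forest G0 e f" for e f
    using fin G0 that by (subst sum_pos2[of _ G0]) auto
  show "?N {Inl 0, Inr 0} {Inl 0, Inr 1} > 0"
    using assms pos[OF ext(1)] by (subst N) auto
  assume m: "m \<ge> 2"
  have n: "n \<ge> 2" using assms by simp
  show "?N {Inl 0, Inr 0} {Inl 1, Inr 0} > 0"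
    using m n pos[OF ext(3)] by (subst N) auto
  \<comment> \<open>Both members of each class have the same count, so the summed inequalities below
    are twice the claimed ones.\<close>
  have eqs: "?N {Inl 1, Inr 0} {Inl 1, Inr 1} = ?N {Inl 0, Inr 0} {Inl 0, Inr 1}"
    "?N {Inl 0, Inr 1} {Inl 1, Inr 1} = ?N {Inl 0, Inr 0} {Inl 1, Inr 0}"
    "?N {Inl 0, Inr 1} {Inl 1, Inr 0} = ?N {Inl 0, Inr 0} {Inl 1, Inr 1}"
    using m n by (subst num_bases_eq; simp)+
  have Ns: "?N {Inl 0, Inr 0} {Inl 0, Inr 1} =
      (\<Sum>G\<in>?S. of_bool (extends_forest G {Inl 0, Inr 0} {Inl 0, Inr 1}))"
    "?N {Inl 1, Inr 0} {Inl 1, Inr 1} =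
      (\<Sum>G\<in>?S. of_bool (extends_forest G {Inl 1, Inr 0} {Inl 1, Inr 1}))"
    "?N {Inl 0, Inr 0} {Inl 1, Inr 0} =
      (\<Sum>G\<in>?S. of_bool (extends_forest G {Inl 0, Inr 0} {Inl 1, Inr 0}))"
    "?N {Inl 0, Inr 1} {Inl 1, Inr 1} =
      (\<Sum>G\<in>?S. of_bool (extends_forest G {Inl 0, Inr 1} {Inl 1, Inr 1}))"
    "?N {Inl 0, Inr 0} {Inl 1, Inr 1} =
      (\<Sum>G\<in>?S. of_bool (extends_forest G {Inl 0, Inr 0} {Inl 1, Inr 1}))"
    "?N {Inl 0, Inr 1} {Inl 1, Inr 0} =
      (\<Sum>G\<in>?S. of_bool (extends_forest G {Inl 0, Inr 1} {Inl 1, Inr 0}))"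
    using m n by (intro N; simp)+
  \<comment> \<open>The second order exchanges the two sides, so that
    \<open>extends_forest_adjacent_le\<close> also treats pairs sharing a right vertex.\<close>
  have dist: "distinct [Inl 0, Inl 1, Inr 0, Inr 1 :: nat + nat]"
    "distinct [Inr 0, Inr 1, Inl 0, Inl 1 :: nat + nat]" by simp_all
  have "?N {Inl 0, Inr 0} {Inl 0, Inr 1} + ?N {Inl 1, Inr 0} {Inl 1, Inr 1} \<le>
      ?N {Inl 0, Inr 0} {Inl 1, Inr 1} + ?N {Inl 0, Inr 1} {Inl 1, Inr 0}"
    unfolding Ns sum.distrib[symmetric] by (intro sum_mono extends_forest_adjacent_le dist)
  thus "?N {Inl 0, Inr 0} {Inl 0, Inr 1} \<le> ?N {Inl 0, Inr 0} {Inl 1, Inr 1}"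
    unfolding eqs by linarith
  have "?N {Inl 0, Inr 0} {Inl 1, Inr 0} + ?N {Inl 0, Inr 1} {Inl 1, Inr 1} \<le>
      ?N {Inl 0, Inr 0} {Inl 1, Inr 1} + ?N {Inl 0, Inr 1} {Inl 1, Inr 0}"
    unfolding Ns sum.distrib[symmetric]
  proof (rule sum_mono)
    fix G :: "(nat + nat) set set"
    have comm: "extends_forest G {Inl 0, Inr 1} {Inl 1, Inr 0} \<longleftrightarrow>
        extends_forest G {Inl 1, Inr 0} {Inl 0, Inr 1}"
      by (auto simp: extends_forest_def insert_commute)
    show "of_bool (extends_forest G {Inl 0, Inr 0} {Inl 1, Inr 0}) +
        of_bool (extends_forest G {Inl 0, Inr 1} {Inl 1, Inr 1}) \<le>
        (of_bool (extends_forest G {Inl 0, Inr 0} {Inl 1, Inr 1}) +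
        of_bool (extends_forest G {Inl 0, Inr 1} {Inl 1, Inr 0}) :: nat)"
      using extends_forest_adjacent_le[OF dist(2), of G]
      by (simp only: comm insert_commute[of "Inr _" "Inl _" "{}"])
  qed
  thus "?N {Inl 0, Inr 0} {Inl 1, Inr 0} \<le> ?N {Inl 0, Inr 0} {Inl 1, Inr 1}"
    unfolding eqs by linarith
  have "?N {Inl 0, Inr 0} {Inl 1, Inr 1} + ?N {Inl 0, Inr 1} {Inl 1, Inr 0} <
      ?N {Inl 0, Inr 0} {Inl 0, Inr 1} + ?N {Inl 1, Inr 0} {Inl 1, Inr 1} +
      ?N {Inl 0, Inr 0} {Inl 1, Inr 0} + ?N {Inl 0, Inr 1} {Inl 1, Inr 1}"
    unfolding Ns sum.distrib[symmetric]
  proof (rule sum_strict_mono_ex1[OF fin])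
    show "\<exists>G\<in>?S. of_bool (extends_forest G {Inl 0, Inr 0} {Inl 1, Inr 1}) +
        of_bool (extends_forest G {Inl 0, Inr 1} {Inl 1, Inr 0}) <
        (of_bool (extends_forest G {Inl 0, Inr 0} {Inl 0, Inr 1}) +
        of_bool (extends_forest G {Inl 1, Inr 0} {Inl 1, Inr 1}) +
        of_bool (extends_forest G {Inl 0, Inr 0} {Inl 1, Inr 0}) +
        of_bool (extends_forest G {Inl 0, Inr 1} {Inl 1, Inr 1}) :: nat)"
      \<comment> \<open>At \<open>G0\<close> all four adjacent pairs count, against at most two
        disjoint ones.\<close>
      using G0 by (intro bexI[of _ G0]) (simp_all add: ext[unfolded One_nat_def])
  qed (intro ballI extends_forest_opposite_le dist)
  thus "?N {Inl 0, Inr 0} {Inl 1, Inr 1} <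
      ?N {Inl 0, Inr 0} {Inl 0, Inr 1} + ?N {Inl 0, Inr 0} {Inl 1, Inr 0}"
    unfolding eqs by linarith
qed

section \<open>Invertibility\<close>

text \<open>The matrix acts as the scalar \<open>l0\<close> on constants, \<open>l1\<close> on
  functions of \<open>i\<close> with sum zero, \<open>l2\<close> on functions of \<open>j\<close>
  with sum zero, and \<open>l\<close> on arrays whose row and column sums all vanish. The system is
  solved explicitly.\<close>

lemma adjacency_matrix_surj:
  fixes a b g :: "'k::field" and m n :: nat and w :: "nat \<Rightarrow> nat \<Rightarrow> 'k"
  defines "l \<equiv> g - a - b"
  defines "l0 \<equiv> g * of_nat m * of_nat n + (a - g) * of_nat n + (b - g) * of_nat m + l"
    and "l1 \<equiv> (a - g) * of_nat n + l" and "l2 \<equiv> (b - g) * of_nat m + l"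
  assumes nz: "l \<noteq> 0" "l0 \<noteq> 0" "l1 \<noteq> 0" "l2 \<noteq> 0"
  shows "\<exists>v. \<forall>i'<m. \<forall>j'<n. (\<Sum>i<m. \<Sum>j<n. v i j *
    (if i = i' then if j = j' then 0 else a else if j = j' then b else g)) = w i' j'"
proof -
  \<comment> \<open>Each entry is \<open>g\<close>, plus \<open>a - g\<close> if
    \<open>i = i'\<close>, plus \<open>b - g\<close> if \<open>j = j'\<close>, plus \<open>l\<close>
    on the diagonal. Summing the system over both indices, over \<open>j\<close> and over
    \<open>i\<close> forces these values for the total, the row sums and the column sums of a
    solution.\<close>
  define T where "T = (\<Sum>i<m. \<Sum>j<n. w i j) / l0"
  define R where "R i = ((\<Sum>j<n. w i j) - (g * of_nat n + (b - g)) * T) / l1" for i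
  define C where "C j = ((\<Sum>i<m. w i j) - (g * of_nat m + (a - g)) * T) / l2" for j
  define v where "v i j = (w i j - g * T - (a - g) * R i - (b - g) * C j) / l" for i j
  have T: "(\<Sum>i<m. \<Sum>j<n. w i j) = l0 * T"
    using nz by (simp add: T_def)
  have R: "(\<Sum>j<n. w i j) = l1 * R i + (g * of_nat n + (b - g)) * T" for i
    using nz by (simp add: R_def)
  have C: "(\<Sum>i<m. w i j) = l2 * C j + (g * of_nat m + (a - g)) * T" for j
    using nz by (simp add: C_def)
  have v: "w i j = l * v i j + g * T + (a - g) * R i + (b - g) * C j" for i j
    using nz by (simp add: v_def)
  \<comment> \<open>The forced values must now be confirmed: \<open>R\<close> and \<open>C\<close>
    both have total \<open>T\<close>, and then \<open>v\<close> has row sums \<open>R\<close> and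
    column sums \<open>C\<close>.\<close>
  have "l1 * sum R {..<m} = l1 * T"
  proof -
    have "l0 * T = l1 * sum R {..<m} + of_nat m * (g * of_nat n + (b - g)) * T"
      unfolding T[symmetric] R by (simp add: sum.distrib sum_distrib_left)
    thus ?thesis by (simp add: l0_def l1_def algebra_simps)
  qed
  hence sumR: "sum R {..<m} = T" using nz by simp
  have "l2 * sum C {..<n} = l2 * T"
  proof -
    have "l0 * T = l2 * sum C {..<n} + of_nat n * (g * of_nat m + (a - g)) * T"
      unfolding T[symmetric] sum.swap[of w] C by (simp add: sum.distrib sum_distrib_left)
    thus ?thesis by (simp add: l0_def l2_def algebra_simps)
  qed
  hence sumC: "sum C {..<n} = T" using nz by simp
  have "l * (\<Sum>j<n. v i j) = l * R i" for i
  proof -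
    have "(\<Sum>j<n. w i j) =
        l * (\<Sum>j<n. v i j) + of_nat n * (g * T) + of_nat n * ((a - g) * R i) + (b - g) * T"
      by (simp add: v sum.distrib sum_distrib_left[symmetric] sumC)
    thus ?thesis unfolding R by (auto simp: l1_def algebra_simps)
  qed
  hence vR: "(\<Sum>j<n. v i j) = R i" for i using nz(1) by (metis mult_left_cancel)
  have "l * (\<Sum>i<m. v i j) = l * C j" for j
  proof -
    have "(\<Sum>i<m. w i j) =
        l * (\<Sum>i<m. v i j) + of_nat m * (g * T) + (a - g) * T + of_nat m * ((b - g) * C j)"
      by (simp add: v sum.distrib sum_distrib_left[symmetric] sumR)
    thus ?thesis unfolding C by (auto simp: l2_def algebra_simps)
  qed
  hence vC: "(\<Sum>i<m. v i j) = C j" for j using nz(1) by (metis mult_left_cancel)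
  have "(\<Sum>i<m. \<Sum>j<n. v i j *
      (if i = i' then if j = j' then 0 else a else if j = j' then b else g)) = w i' j'"
    if ij: "i' < m" "j' < n" for i' j'
  proof -
    have "(\<Sum>i<m. \<Sum>j<n. v i j *
        (if i = i' then if j = j' then 0 else a else if j = j' then b else g)) =
      (\<Sum>i<m. \<Sum>j<n. g * v i j + (if i = i' then (a - g) * v i j else 0) +
        (if j = j' then (b - g) * v i j else 0) +
        (if i = i' then if j = j' then l * v i j else 0 else 0))"
      by (intro sum.cong refl) (simp add: l_def algebra_simps)
    also have "\<dots> = g * (\<Sum>i<m. \<Sum>j<n. v i j) + (a - g) * (\<Sum>j<n. v i' j) +
        (b - g) * (\<Sum>i<m. v i j') + l * v i' j'"
    proof -
      have *: "(\<Sum>j<n. if i = i' then f j else 0) = (if i = i' then \<Sum>j<n. f j else 0)"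
        for i and f :: "nat \<Rightarrow> 'k" by simp
      show ?thesis
        using ij by (simp add: sum.distrib * sum_distrib_left)
    qed
    also have "\<dots> = w i' j'"
      by (simp add: vR vC sumR v)
    finally show ?thesis .
  qed
  thus ?thesis by blast
qed

lemma bases_matrix_surj:
  fixes w :: "(nat + nat) set \<Rightarrow> 'k::field_char_0"
  assumes "0 < m" "2 < r" "r < n" "0 < c"
  shows "\<exists>v. \<forall>f\<in>complete_bipartite m n. (\<Sum>e\<in>complete_bipartite m n. v e *
    (if e = f then 0 else of_nat (c * num_bases m n r e f))) = w f"
proof -
  let ?E = "complete_bipartite m n"
  define A where "A = c * num_bases m n r {Inl 0, Inr 0} {Inl 0, Inr 1}"
  define B where "B = c * num_bases m n r {Inl 0, Inr 0} {Inl 1, Inr 0}"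
  define G where "G = c * num_bases m n r {Inl 0, Inr 0} {Inl 1, Inr 1}"
  define edge :: "nat \<times> nat \<Rightarrow> (nat + nat) set" where "edge = (\<lambda>(i, j). {Inl i, Inr j})"
  have bij: "bij_betw edge ({..<m} \<times> {..<n}) ?E"
    unfolding edge_def by (rule bij_betw_complete_bipartite)
  have "m \<ge> 1" using assms(1) by simp
  note counts = num_bases_inequalities[OF this assms(2,3)]
  have A: "A > 0" using counts(1) assms(4) by (simp add: A_def)
  \<comment> \<open>For \<open>m \<ge> 2\<close> the scalars \<open>l\<close>, \<open>l1\<close> and
    \<open>l2\<close> are negative; this is stated without subtraction to stay in the natural
    numbers.\<close>
  have ineqs: "G < A + B \<and> A * n + G < G * n + A + B \<and> B * m + G < G * m + A + B" if m: "m \<ge> 2"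
  proof -
    have B: "B > 0" using counts(2)[OF m] assms(4) by (simp add: B_def)
    have AG: "A \<le> G" unfolding A_def G_def using counts(4)[OF m] by (rule mult_le_mono2)
    have BG: "B \<le> G" unfolding B_def G_def using counts(5)[OF m] by (rule mult_le_mono2)
    have "G < A + B"
      unfolding A_def B_def G_def distrib_left[symmetric]
      using counts(3)[OF m] assms(4) by (rule mult_less_mono2)
    moreover obtain n' m' where nm: "n = Suc n'" "m = Suc m'"
      using assms by (metis Suc_pred gr_implies_not0 not_gr_zero)
    moreover have "A * n' < G * n' + B"
      using mult_le_mono1[OF AG, of n'] B by linarith
    moreover have "B * m' < G * m' + A"
      using mult_le_mono1[OF BG, of m'] A by linarith
    ultimately show ?thesis by simp
  qed
  \<comment> \<open>For \<open>m = 1\<close> the vertex \<open>Inl 1\<close> does not occur, and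
    \<open>l\<close>, \<open>l1\<close>, \<open>l2\<close> become \<open>- A\<close>,
    \<open>A * (n - 1)\<close>, \<open>- A\<close>.\<close>
  have trivial: "B = 0 \<and> G = 0" if "m = 1"
  proof -
    have "{Inl 1, Inr j} \<notin> ?E" for j
      using that by (auto simp: complete_bipartite_def doubleton_eq_iff)
    hence "num_bases m n r e {Inl 1, Inr j} = 0" for e j
      by (auto simp: num_bases_def truncated_graphic_bases_def)
    thus ?thesis by (simp add: B_def G_def)
  qed
  have ne: "G \<noteq> A + B" "A * n + G \<noteq> G * n + A + B" "B * m + G \<noteq> G * m + A + B"
    using ineqs trivial A assms by (cases "m = 1"; force)+
  \<comment> \<open>This is \<open>l0 > 0\<close>: the difference of the two sides is
    \<open>G * (m - 1) * (n - 1) + A * (n - 1) + B * (m - 1)\<close>.\<close>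
  have ne0: "G * n + G * m + A + B < G * m * n + A * n + B * m + G"
  proof -
    obtain n' m' where nm: "n = Suc (Suc n')" "m = Suc m'"
      using assms by (metis Suc_pred less_trans numeral_2_eq_2 zero_less_Suc diff_Suc_Suc
          Suc_lessE)
    show ?thesis using A by (simp add: nm algebra_simps)
  qed
  \<comment> \<open>Characteristic zero enters here: \<open>of_nat\<close> is injective, so the
    inequalities of numbers give nonzero scalars in the field.\<close>
  have "of_nat G \<noteq> (of_nat (A + B) :: 'k)" "of_nat (A * n + G) \<noteq> (of_nat (G * n + A + B) :: 'k)"
    "of_nat (B * m + G) \<noteq> (of_nat (G * m + A + B) :: 'k)"
    "of_nat (G * n + G * m + A + B) \<noteq> (of_nat (G * m * n + A * n + B * m + G) :: 'k)"
    using ne ne0 unfolding of_nat_eq_iff by simp_all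
  hence nz: "of_nat G - of_nat A - of_nat B \<noteq> (0::'k)"
    "of_nat G * of_nat m * of_nat n + (of_nat A - of_nat G) * of_nat n +
      (of_nat B - of_nat G) * of_nat m + (of_nat G - of_nat A - of_nat B) \<noteq> (0::'k)"
    "(of_nat A - of_nat G) * of_nat n + (of_nat G - of_nat A - of_nat B) \<noteq> (0::'k)"
    "(of_nat B - of_nat G) * of_nat m + (of_nat G - of_nat A - of_nat B) \<noteq> (0::'k)"
    by (auto simp: algebra_simps)
  have entry: "(if edge (i, j) = edge (i', j') then 0
      else of_nat (c * num_bases m n r (edge (i, j)) (edge (i', j')))) =
      (if i = i' then if j = j' then 0 else of_nat A else if j = j' then of_nat B else of_nat G :: 'k)"
    if "i < m" "i' < m" "j < n" "j' < n" for i j i' j'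
    using that num_bases_eq[of i m i' j n j' r]
    by (auto simp: edge_def doubleton_eq_iff A_def B_def G_def)
  obtain u where u: "\<And>i' j'. i' < m \<Longrightarrow> j' < n \<Longrightarrow> (\<Sum>i<m. \<Sum>j<n. u i j *
    (if i = i' then if j = j' then 0 else of_nat A else if j = j' then of_nat B else of_nat G)) =
    w (edge (i', j'))"
    using adjacency_matrix_surj[OF nz, of "\<lambda>i j. w (edge (i, j))"] by blast
  define v where "v e = case_prod u (inv_into ({..<m} \<times> {..<n}) edge e)" for e
  have v: "v (edge (i, j)) = u i j" if "i < m" "j < n" for i j
    using bij_betw_inv_into_left[OF bij, of "(i, j)"] that by (simp add: v_def)
  have "(\<Sum>e\<in>?E. v e * (if e = f then 0 else of_nat (c * num_bases m n r e f))) = w f"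
    if "f \<in> ?E" for f
  proof -
    from that obtain i' j' where f: "f = edge (i', j')" "i' < m" "j' < n"
      by (auto simp: edge_def complete_bipartite_def)
    have "(\<Sum>e\<in>?E. v e * (if e = f then 0 else of_nat (c * num_bases m n r e f))) =
      (\<Sum>x\<in>{..<m} \<times> {..<n}. v (edge x) *
        (if edge x = f then 0 else of_nat (c * num_bases m n r (edge x) f)))"
      by (rule sum.reindex_bij_betw[OF bij, symmetric])
    also have "\<dots> = (\<Sum>i<m. \<Sum>j<n. v (edge (i, j)) *
        (if edge (i, j) = f then 0 else of_nat (c * num_bases m n r (edge (i, j)) f)))"
      unfolding sum.cartesian_product by (rule sum.cong) auto
    also have "\<dots> = (\<Sum>i<m. \<Sum>j<n. u i j *
      (if i = i' then if j = j' then 0 else of_nat A else if j = j' then of_nat B else of_nat G))"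
      unfolding f(1)
    proof (intro sum.cong refl)
      fix i j assume "i \<in> {..<m}" "j \<in> {..<n}"
      hence ij: "i < m" "j < n" by simp_all
      show "v (edge (i, j)) * (if edge (i, j) = edge (i', j') then 0
          else of_nat (c * num_bases m n r (edge (i, j)) (edge (i', j')))) =
        u i j * (if i = i' then if j = j' then 0 else of_nat A else if j = j' then of_nat B else of_nat G)"
        by (simp only: v[OF ij] entry[OF ij(1) f(2) ij(2) f(3)])
    qed
    also have "\<dots> = w f" using u f by simp
    finally show ?thesis .
  qed
  thus ?thesis by blast
qed

theorem theorem3p9:
  fixes m n r :: nat
    and E :: "(nat + nat) set set"
    and \<Phi> L :: "((nat + nat) set, 'k::field_char_0) mpoly"
  assumes "0 < m" and "0 < n" and "2 < r" and "r < n"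
    and "E = complete_bipartite m n"
    and "\<Phi> = basis_gen_poly (truncated_graphic_bases E r)"
    and "L = (\<Sum>e\<in>E. Var e)"
  shows "bij_betw
    (\<lambda>a. (residue_class E \<Phi> L [^]\<^bsub>quot_alg E \<Phi>\<^esub> (r - 2)) \<otimes>\<^bsub>quot_alg E \<Phi>\<^esub> a)
    (quot_alg_comp E \<Phi> 1) (quot_alg_comp E \<Phi> (r - 1))"
proof (rule bij_betw_mult_power_residue_class
    [where H = "\<lambda>e f. if e = f then 0 else of_nat (fact (r - 2) * num_bases m n r e f)"])
  show fin: "finite E" using assms(5) by simp
  have \<B>: "B \<subseteq> E \<and> card B = r" if "B \<in> truncated_graphic_bases E r" for B
    using that by (simp add: truncated_graphic_bases_def)
  show "\<Phi> \<in> homogeneous E r"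
    unfolding assms(6) basis_gen_poly_def
  proof (rule homogeneous_sum)
    fix B assume "B \<in> truncated_graphic_bases E r"
    thus "(\<Prod>b\<in>B. Var b) \<in> homogeneous E r"
      using \<B>[of B] homogeneous_prod_Var[of B E] finite_subset[OF _ fin] by auto
  qed
  show "L \<in> homogeneous E 1"
    unfolding assms(7) by (intro homogeneous_sum homogeneous_Var)
  show "2 \<le> r" using assms(3) by simp
  fix e f assume "e \<in> E" "f \<in> E"
  show "diff_op (L ^ (r - 2) * (Var e * Var f)) \<Phi> =
      Const (if e = f then 0 else of_nat (fact (r - 2) * num_bases m n r e f))"
    unfolding assms(6) num_bases_def assms(5)[symmetric]
    by (rule diff_op_basis_gen_poly[OF assms(7) fin \<B>])
next
  \<comment> \<open>The factor \<open>c\<close> of \<open>bases_matrix_surj\<close> is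
    \<open>fact (r - 2)\<close>, which is positive.\<close>
  fix w :: "(nat + nat) set \<Rightarrow> 'k"
  show "\<exists>v. \<forall>f\<in>E. (\<Sum>e\<in>E. v e *
      (if e = f then 0 else of_nat (fact (r - 2) * num_bases m n r e f))) = w f"
    unfolding assms(5) using assms(1,3,4) by (intro bases_matrix_surj) auto
qed

end
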